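(* For every integer $q\ge 5$, there is an order-multiplicial 4-polytope with $q$ vertices having a facet containing $\lceil (2q+2)/3\rceil$ vertices.
   Context: A $d$-dimensional multiplex ($d\ge 2$) is a $d$-dimensional convex polytope with an ordered list of vertices $x_0,x_1,\ldots,x_n$ whose facets are $F_0,F_1,\ldots,F_n$, where $F_i=\mathrm{conv}\{x_{i-d+1},x_{i-d+2},\ldots,x_{i-1},x_{i+1},x_{i+2},\ldots,x_{i+d-1}\}$, with the conventions $x_i=x_0$ if $i<0$ and $x_i=x_n$ if $i>n$. Polytopes of dimension at most $1$ (empty set, points, segments) are counted as multiplexes, with any vertex ordering. A convex polytope $P$ is order-multiplicial if for some ordering $v_0,v_1,\ldots,v_n$ of the vertices of $P$, every proper face of $P$ is a multiplex with the induced ordering of its vertices. *)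

theory Defs
  imports "HOL-Analysis.Analysis"
begin

definition vertices :: "'a::euclidean_space set \<Rightarrow> 'a set" where
  "vertices P = {v. v extreme_point_of P}"

definition vertex_ordering :: "'a::euclidean_space set \<Rightarrow> 'a list \<Rightarrow> bool" where
  "vertex_ordering P xs \<longleftrightarrow> distinct xs \<and> set xs = vertices P"

text \<open>Clamped indexing into \<open>x\<^sub>0, \<dots>, x\<^sub>n\<close>: \<open>x\<^sub>i = x\<^sub>0\<close> for \<open>i < 0\<close> and \<open>x\<^sub>i = x\<^sub>n\<close> for \<open>i > n\<close>
  (only meant for nonempty lists).\<close>
definition clamped_nth :: "'a list \<Rightarrow> int \<Rightarrow> 'a" where
  "clamped_nth xs i =
     (if i < 0 then hd xs else if i \<ge> int (length xs) then last xs else xs ! nat i)"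

definition multiplex_facet :: "nat \<Rightarrow> 'a::euclidean_space list \<Rightarrow> int \<Rightarrow> 'a set" where
  "multiplex_facet d xs i =
     convex hull (clamped_nth xs ` ({i - int d + 1..i - 1} \<union> {i + 1..i + int d - 1}))"

text \<open>A \<open>d\<close>-dimensional polytope has at least \<open>d + 1\<close> vertices, and then the vertex sets listed in
  \<^const>\<open>multiplex_facet\<close> are pairwise distinct for \<open>i = 0, \<dots>, n\<close>; so it is enough to compare
  the facets with the \<open>F\<^sub>i\<close> as sets.\<close>
definition multiplex_of_dim :: "nat \<Rightarrow> 'a::euclidean_space set \<Rightarrow> 'a list \<Rightarrow> bool" where
  "multiplex_of_dim d P xs \<longleftrightarrow>
     d \<ge> 2 \<and> polytope P \<and> aff_dim P = int d \<and> vertex_ordering P xs \<and>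
     {F. F facet_of P} = multiplex_facet d xs ` {0..<int (length xs)}"

definition multiplex :: "'a::euclidean_space set \<Rightarrow> 'a list \<Rightarrow> bool" where
  "multiplex P xs \<longleftrightarrow>
     (polytope P \<and> aff_dim P \<le> 1 \<and> vertex_ordering P xs) \<or> (\<exists>d. multiplex_of_dim d P xs)"

text \<open>The vertices of a face \<open>F\<close> of \<open>P\<close> are the vertices of \<open>P\<close> lying in \<open>F\<close>, so filtering the
  vertex list of \<open>P\<close> yields the induced ordering of the vertices of \<open>F\<close>.\<close>
definition order_multiplicial :: "'a::euclidean_space set \<Rightarrow> bool" where
  "order_multiplicial P \<longleftrightarrow>
     polytope P \<and>
     (\<exists>vs. vertex_ordering P vs \<and>
       (\<forall>F. F face_of P \<and> F \<noteq> P \<longrightarrow> multiplex F (filter (\<lambda>v. v \<in> F) vs)))"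

end

(* The base is the convex hull of a staircase x_0, ..., x_n in R^3 whose k-th step goes in the
   coordinate direction k mod 3 and has length 6 (k + 1).  Steps k and k + 3 are parallel, so
   x_k, x_(k+1), x_(k+3), x_(k+4) form a trapezoid, and log-concavity of the step lengths makes
   the planes of these trapezoids supporting: the base is a 3-multiplex.

   Over it we put top points y_j at (t^2, t^2, t^2, t) with t = 2 j + 1, j = 1, ..., m.  After
   scaling, the supporting functional of F_i takes the value t^2 + (i + 2) (i - 1) at the axis point
   (t^2, t^2, t^2), so the facet over F_i has as apex the y_j minimising t + (i + 2) (i - 1) / t.
   For 2 <= i <= n - 2 this is j = i div 2, which is unique because the product of two values of t
   is odd while (i + 2) (i - 1) is even.  A functional that is nonnegative on the whole polytope
   therefore vanishes on the base, or on a trapezoid and at most the matching y_j, or on an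
   affinely independent set of vertices.  Placing y_j between x_(2j) and x_(2j+1) puts each apex in
   the middle of its trapezoids, so the pyramids are 3-multiplexes too. *)

theory Submission imports Defs begin

section \<open>Faces and vertices of polytopes\<close>

text \<open>The ratio 2/3 comes from the vertex order. In a 3-multiplex with five vertices only the
  facet opposite the middle vertex is a quadrilateral, so the apex over the trapezoid F_i must come
  between x_(i-1) and x_(i+1). A top point in one gap of the staircase can do this for at most two
  trapezoids, and the base has n - 3 of them. Hence n <= 2 m + 3, which for q = n + 1 + m reads 3 n
  <= 2 q + 1. The obstacle is to force one prescribed apex on two neighbouring trapezoids. With B =
  (i + 2) (i - 1) = (i + 1/2)^2 - 9/4, the function t + B / t is least at the square root of B,
  close to i + 1/2, and the nearest odd integer is 2 (i div 2) + 1, the same for i = 2 j and i = 2 j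
  + 1. The parabola serves to produce this function: it is t^2 + B divided by the height t. The
  facets of the tower are never listed. Every face of a polytope is exposed, so it is enough to know
  where nonnegative functionals vanish.\<close>

lemma face_of_convex_hull_exposed:
  fixes S :: "'a::euclidean_space set"
  assumes "finite S" "\<And>x. x \<in> S \<Longrightarrow> c \<le> v \<bullet> x"
  shows "convex hull {x \<in> S. v \<bullet> x = c} face_of convex hull S"
proof -
  have ge: "c \<le> v \<bullet> x" if "x \<in> convex hull S" for x
  proof -
    have "convex hull S \<subseteq> {x. v \<bullet> x \<ge> c}"
      using assms(2) by (intro hull_minimal) (auto simp: convex_halfspace_ge)
    then show ?thesis using that by auto
  qed
  define G where "G = convex hull S \<inter> {x. v \<bullet> x = c}"
  have G: "G face_of convex hull S"
    unfolding G_def by (rule face_of_Int_supporting_hyperplane_ge) (auto simp: ge)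
  obtain S' where S': "S' \<subseteq> S" "G = convex hull S'"
    using face_of_convex_hull_subset[OF finite_imp_compact[OF assms(1)] G] by blast
  have "S' \<subseteq> {x \<in> S. v \<bullet> x = c}"
    using S' hull_subset[of S' convex] by (auto simp: G_def)
  then have "G \<subseteq> convex hull {x \<in> S. v \<bullet> x = c}"
    using S'(2) hull_mono by blast
  moreover have "convex hull {x \<in> S. v \<bullet> x = c} \<subseteq> G"
    unfolding G_def
    by (intro hull_minimal) (auto simp: convex_Int convex_hyperplane hull_inc)
  ultimately show ?thesis using G by auto
qed

lemma face_of_convex_hull_imp_exposed:
  fixes S :: "'a::euclidean_space set"
  assumes "finite S" "G face_of convex hull S"
  obtains v c where "\<And>x. x \<in> S \<Longrightarrow> c \<le> v \<bullet> x" "\<And>x. x \<in> S \<Longrightarrow> x \<in> G \<longleftrightarrow> v \<bullet> x = c"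
proof -
  have "G exposed_face_of convex hull S"
    using assms by (simp add: exposed_face_of_polyhedron polyhedron_convex_hull)
  then obtain a b where "convex hull S \<subseteq> {x. a \<bullet> x \<le> b}" "G = convex hull S \<inter> {x. a \<bullet> x = b}"
    unfolding exposed_face_of_def by blast
  then show thesis
    by (intro that[of "-b" "-a"]) (auto dest: subsetD[OF hull_subset])
qed

lemma vertices_face:
  assumes "G face_of P"
  shows "vertices G = vertices P \<inter> G"
  using assms by (auto simp: vertices_def extreme_point_of_face)

lemma polytope_eq_hull_vertices:
  assumes "polytope P"
  shows "P = convex hull (vertices P)"
  unfolding vertices_def
  using assms by (intro Krein_Milman_Minkowski) (auto simp: polytope_imp_compact polytope_imp_convex)

lemma vertices_convex_hull_subset: "vertices (convex hull S) \<subseteq> S"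
  by (auto simp: vertices_def extreme_point_of_convex_hull)

lemma vertex_exposed:
  fixes S :: "'a::euclidean_space set"
  assumes "finite S" "p \<in> S" "\<And>x. x \<in> S \<Longrightarrow> x \<noteq> p \<Longrightarrow> v \<bullet> p < v \<bullet> x"
  shows "p \<in> vertices (convex hull S)"
proof -
  have "{x \<in> S. v \<bullet> x = v \<bullet> p} = {p}"
    using assms(2,3) by force
  moreover have "convex hull {x \<in> S. v \<bullet> x = v \<bullet> p} face_of convex hull S"
    using assms by (intro face_of_convex_hull_exposed) (metis order.order_iff_strict)+
  ultimately show ?thesis by (simp add: vertices_def face_of_singleton)
qed

section \<open>Simplices, trapezoids and their pyramids as multiplexes\<close>

lemma clamped_nth_eq:
  assumes "xs \<noteq> []"
  shows "clamped_nth xs i = xs ! nat (max 0 (min (int (length xs) - 1) i))"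
  using assms
  by (auto simp: clamped_nth_def hd_conv_nth last_conv_nth max_def min_def nat_diff_distrib
      intro!: arg_cong[where f = "(!) xs"])

lemma multiplex_facet_2:
  "multiplex_facet 2 xs i = convex hull {clamped_nth xs (i - 1), clamped_nth xs (i + 1)}"
proof -
  have "{i - int 2 + 1..i - 1} \<union> {i + 1..i + int 2 - 1} = {i - 1, i + 1}" by auto
  then show ?thesis by (simp add: multiplex_facet_def)
qed

lemma multiplex_facet_3:
  "multiplex_facet 3 xs i = convex hull
     {clamped_nth xs (i - 2), clamped_nth xs (i - 1), clamped_nth xs (i + 1), clamped_nth xs (i + 2)}"
proof -
  have "{i - int 3 + 1..i - 1} \<union> {i + 1..i + int 3 - 1} = {i - 2, i - 1, i + 1, i + 2}" by auto
  then show ?thesis by (simp add: multiplex_facet_def)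
qed

text \<open>With d + 1 vertices the two windows around i reach every other index, and whatever
  sticks out is clamped to an end. Hence any order of affinely independent vertices will do, and
  only the base, the trapezoids and their pyramids need attention to the order.\<close>

lemma multiplex_simplex:
  fixes S :: "'a::euclidean_space set"
  assumes S: "\<not> affine_dependent S" and xs: "distinct xs" "set xs = S"
  shows "multiplex (convex hull S) xs"
proof -
  have fin: "finite S" using xs by auto
  have card: "card S = length xs" using xs distinct_card by blast
  have dim: "aff_dim (convex hull S) = int (length xs) - 1"
    using aff_dim_affine_independent[OF S] card by (simp add: aff_dim_convex_hull)
  have poly: "polytope (convex hull S)" using fin by (auto simp: polytope_def)
  have vert: "vertices (convex hull S) = S"
    using S by (auto simp: vertices_def extreme_point_of_convex_hull_affine_independent)
  show ?thesis
  proof (cases "length xs \<le> 2")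
    case True
    then show ?thesis using poly vert dim xs by (simp add: multiplex_def vertex_ordering_def)
  next
    case False
    define d where "d = length xs - 1"
    have d: "d \<ge> 2" "length xs = Suc d" using False by (auto simp: d_def)
    \<comment> \<open>The clamping swaps the two extreme vertices: \<open>F\<^sub>0\<close> misses \<open>x\<^sub>d\<close> and \<open>F\<^sub>d\<close> misses \<open>x\<^sub>0\<close>.\<close>
    define s where "s i = (if i = 0 then d else if i = d then 0 else i)" for i
    have ss: "s ` {..d} = {..d}"
      using d by (force simp: s_def image_iff)
    have S_nth: "S = (!) xs ` {..d}"
      using xs d by (auto simp: set_conv_nth)
    have facet: "multiplex_facet d xs (int i) = convex hull (S - {xs ! s i})" if "i \<le> d" for i
    proof -
      define I where "I = {int i - int d + 1..int i - 1} \<union> {int i + 1..int i + int d - 1}"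
      have "clamped_nth xs j = xs ! nat (max 0 (min (int d) j))" for j
        using d by (subst clamped_nth_eq) auto
      then have "clamped_nth xs ` I = (!) xs ` ((\<lambda>j. nat (max 0 (min (int d) j))) ` I)"
        by (simp add: image_image)
      also have "(\<lambda>j. nat (max 0 (min (int d) j))) ` I = {..d} - {s i}" (is "?f ` I = ?R")
      proof
        show "?f ` I \<subseteq> ?R"
        proof (rule image_subsetI)
          fix j assume "j \<in> I"
          moreover have "?f j = (if j < 0 then 0 else if j > int d then d else nat j)" by auto
          ultimately show "?f j \<in> ?R"
            using that d by (auto simp: I_def s_def)
        qed
        show "?R \<subseteq> ?f ` I"
        proof
          fix j assume j: "j \<in> ?R"
          \<comment> \<open>The index \<open>i\<close> itself is reached only by clamping, from -1
            if it is 0 and from d + 1 if it is d.\<close>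
          define j' where "j' = (if j = i then (if i = 0 then -1 else int d + 1) else int j)"
          have "j' \<in> I" "?f j' = j"
            using j that d by (auto simp: I_def s_def j'_def split: if_splits)
          then show "j \<in> ?f ` I" by (metis imageI)
        qed
      qed
      also have "(!) xs ` ({..d} - {s i}) = S - {xs ! s i}"
      proof -
        have "s i \<le> d" using that by (auto simp: s_def)
        moreover have "inj_on ((!) xs) {..d}"
          using xs d by (auto intro!: inj_on_nth)
        ultimately show ?thesis by (simp add: S_nth inj_on_image_set_diff[where C = "{..d}"])
      qed
      finally show ?thesis by (simp add: multiplex_facet_def I_def)
    qed
    have "{0..<int (length xs)} = int ` {..d}"
      using d by (auto simp: image_iff intro!: bexI[where x = "nat x" for x])
    then have "multiplex_facet d xs ` {0..<int (length xs)} = (\<lambda>i. convex hull (S - {xs ! i})) ` (s ` {..d})"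
      using facet by (simp add: image_image)
    also have "\<dots> = (\<lambda>u. convex hull (S - {u})) ` S"
      unfolding ss by (simp add: S_nth image_image)
    also have "\<dots> = {F. F facet_of convex hull S}"
    proof -
      have "convex hull (S - {u}) \<noteq> {}" if "u \<in> S" for u
      proof -
        have "card (S - {u}) = d" using that card d fin by simp
        then show ?thesis using d by (metis card.empty convex_hull_eq_empty not_numeral_le_zero)
      qed
      then show ?thesis
        by (auto simp: facet_of_convex_hull_affine_independent[OF S])
    qed
    finally have "multiplex_of_dim d (convex hull S) xs"
      using d poly dim xs vert by (simp add: multiplex_of_dim_def vertex_ordering_def)
    then show ?thesis by (auto simp: multiplex_def)
  qed
qed

text \<open>A face of a pyramid is a face of its base or the join of one with the apex, and the join
  raises the dimension by one.\<close>

lemma facets_pyramid: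
  fixes S :: "'a::euclidean_space set"
  assumes "finite S" "p \<notin> affine hull S" "aff_dim S \<ge> 1"
  shows "{T. T facet_of convex hull (insert p S)} =
    insert (convex hull S) ((\<lambda>T. convex hull (insert p T)) ` {T. T facet_of convex hull S})"
proof -
  have dimP: "aff_dim (convex hull (insert p S)) = aff_dim S + 1"
    using assms(2) by (simp add: aff_dim_convex_hull aff_dim_insert)
  have dimC: "aff_dim (convex hull (insert p T)) = aff_dim T + 1" if "T face_of convex hull S" for T
  proof -
    have "T \<subseteq> affine hull S"
      using face_of_imp_subset[OF that] convex_hull_subset_affine_hull by blast
    then have "p \<notin> affine hull T"
      using assms(2) hull_minimal[of T "affine hull S" affine] by auto
    then show ?thesis by (simp add: aff_dim_convex_hull aff_dim_insert)
  qed
  have eqS: "T = convex hull S" if "T face_of convex hull S" "aff_dim T = aff_dim S" for T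
    using that face_of_aff_dim_lt[of "convex hull S" T] by (auto simp: aff_dim_convex_hull)
  have faces: "T face_of convex hull (insert p S) \<longleftrightarrow> T face_of convex hull S \<or>
      (\<exists>T'. T' face_of convex hull S \<and> T = convex hull (insert p T'))" for T
    by (rule face_of_convex_hull_insert_eq[OF assms(1,2)])
  show ?thesis
  proof (intro equalityI subsetI)
    fix T assume "T \<in> {T. T facet_of convex hull (insert p S)}"
    then have T: "T face_of convex hull (insert p S)" "aff_dim T = aff_dim S"
      using dimP by (auto simp: facet_of_def)
    from T(1) consider "T face_of convex hull S"
      | T' where "T' face_of convex hull S" "T = convex hull (insert p T')"
      unfolding faces by blast
    then show "T \<in> insert (convex hull S) ((\<lambda>T. convex hull (insert p T)) ` {T. T facet_of convex hull S})"
    proof cases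
      case 1
      then show ?thesis using eqS T(2) by auto
    next
      case 2
      then have "aff_dim T' = aff_dim S - 1" using dimC T(2) by simp
      \<comment> \<open>The dimension bound on \<open>S\<close> enters here: \<open>facet_of\<close>
        does not admit the empty face.\<close>
      moreover from this have "T' \<noteq> {}" using assms(3) by auto
      ultimately have "T' facet_of convex hull S"
        using 2 by (simp add: facet_of_def aff_dim_convex_hull)
      then show ?thesis using 2 by auto
    qed
  next
    fix T assume "T \<in> insert (convex hull S) ((\<lambda>T. convex hull (insert p T)) ` {T. T facet_of convex hull S})"
    then consider "T = convex hull S"
      | T' where "T' facet_of convex hull S" "T = convex hull (insert p T')" by blast
    then show "T \<in> {T. T facet_of convex hull (insert p S)}"
    proof cases
      case 1
      moreover have "S \<noteq> {}" using assms(3) by auto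
      ultimately show ?thesis
        using dimP by (auto simp: facet_of_def faces aff_dim_convex_hull face_of_refl)
    next
      case 2
      then show ?thesis
        using dimP dimC[of T'] by (auto simp: facet_of_def faces aff_dim_convex_hull)
    qed
  qed
qed

lemma trapezoid_in_plane:
  fixes a b c d :: "'a::euclidean_space"
  assumes "d = c + k *\<^sub>R (b - a)"
  shows "affine hull {a, b, c, d} = affine hull {a, b, c}"
proof -
  have "d \<in> affine hull {a, b, c}"
    unfolding affine_hull_3 mem_Collect_eq
    by (rule exI[of _ "-k"], rule exI[of _ k], rule exI[of _ 1]) (simp add: assms algebra_simps)
  then have "affine hull (insert d {a, b, c}) = affine hull {a, b, c}"
    by (rule hull_redundant)
  then show ?thesis by (simp add: insert_commute)
qed

lemma aff_dim_trapezoid: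
  fixes a b c d :: "'a::euclidean_space"
  assumes "\<not> affine_dependent {a, b, c}" "a \<noteq> b" "a \<noteq> c" "b \<noteq> c" "d = c + k *\<^sub>R (b - a)"
  shows "aff_dim {a, b, c, d} = 2"
proof -
  have "aff_dim {a, b, c, d} = aff_dim {a, b, c}"
    using trapezoid_in_plane[OF assms(5)] by (metis aff_dim_affine_hull)
  also have "\<dots> = 2" using aff_dim_affine_independent[OF assms(1)] assms by simp
  finally show ?thesis .
qed

text \<open>The sides ab and cd are parallel and equally directed, so the cyclic order is a, b, d, c
  with diagonals ad and bc. This makes a, b, c, d, and not the cyclic order, the multiplex order.
  Each side is exposed by prescribing a functional on the independent vectors b - a and c -
  a.\<close>

lemma facets_trapezoid:
  fixes a b c d :: "'a::euclidean_space"
  assumes indep: "\<not> affine_dependent {a, b, c}" and ne: "a \<noteq> b" "a \<noteq> c" "b \<noteq> c"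
    and k: "k > 0" and d: "d = c + k *\<^sub>R (b - a)"
  shows "{T. T facet_of convex hull {a, b, c, d}} =
    {convex hull {a, b}, convex hull {a, c}, convex hull {b, d}, convex hull {c, d}}"
proof -
  have fin: "finite {a, b, c, d}" by simp
  have indep2: "independent {b - a, c - a}"
  proof -
    have "a \<notin> {b, c}" using ne by auto
    then have "\<not> dependent ((\<lambda>x. - a + x) ` {b, c})"
      using indep dependent_imp_affine_dependent[of a "{b,c}"] affine_dependent_iff_dependent[of a "{b,c}"] by simp
    then show ?thesis by (simp add: algebra_simps)
  qed
  have dim: "aff_dim {a, b, c, d} = 2" by (rule aff_dim_trapezoid[OF indep ne d])
  have ex: "\<exists>v. v \<bullet> (b - a) = s \<and> v \<bullet> (c - a) = t" for s t :: real
  proof -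
    obtain g where g: "linear g" "\<And>x. x \<in> {b - a, c - a} \<Longrightarrow> g x = (if x = b - a then s else t)"
      using linear_independent_extend[OF indep2, of "\<lambda>x. if x = b - a then s else t"] by blast
    have "g x = x \<bullet> adjoint g 1" for x
      using adjoint_works[OF g(1), of x 1] by simp
    then show ?thesis
      using g(2)[of "b - a"] g(2)[of "c - a"] ne by (intro exI[of _ "adjoint g 1"]) (simp add: inner_commute)
  qed
  have side: "convex hull {p, q} facet_of convex hull {a, b, c, d}"
    if v: "\<And>x. x \<in> {a, b, c, d} \<Longrightarrow> e \<le> v \<bullet> x \<and> (v \<bullet> x = e \<longleftrightarrow> x \<in> {p, q})"
      and pq: "{p, q} \<subseteq> {a, b, c, d}" "p \<noteq> q" for v e p q
  proof -
    have "{x \<in> {a, b, c, d}. v \<bullet> x = e} = {p, q}" using v pq(1) by blast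
    then have "convex hull {p, q} face_of convex hull {a, b, c, d}"
      using face_of_convex_hull_exposed[OF fin, of e v] v by simp
    then show ?thesis using dim pq(2) by (simp add: facet_of_def aff_dim_convex_hull)
  qed
  have cd: "c \<noteq> d" using k ne d by auto
  have bd: "b \<noteq> d" "a \<noteq> d"
  proof -
    obtain v where "v \<bullet> (b - a) = 0" "v \<bullet> (c - a) = 1" using ex by blast
    then have "v \<bullet> d = v \<bullet> a + 1" "v \<bullet> b = v \<bullet> a" unfolding d by (auto simp: inner_simps)
    then show "b \<noteq> d" "a \<noteq> d" by auto
  qed
  show ?thesis
  proof (intro equalityI subsetI)
    fix T assume "T \<in> {T. T facet_of convex hull {a, b, c, d}}"
    then have T: "T face_of convex hull {a, b, c, d}" "aff_dim T = 1"
      using dim by (auto simp: facet_of_def aff_dim_convex_hull)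
    obtain v e where v: "\<And>x. x \<in> {a, b, c, d} \<Longrightarrow> e \<le> v \<bullet> x"
      "\<And>x. x \<in> {a, b, c, d} \<Longrightarrow> x \<in> T \<longleftrightarrow> v \<bullet> x = e"
      using face_of_convex_hull_imp_exposed[OF fin T(1)] by metis
    obtain S' where S': "S' \<subseteq> {a, b, c, d}" "T = convex hull S'"
      using face_of_convex_hull_subset[OF finite_imp_compact[OF fin] T(1)] by blast
    define W where "W = {a, b, c, d} \<inter> T"
    have W: "T = convex hull W"
    proof
      show "T \<subseteq> convex hull W"
      proof -
        have "S' \<subseteq> W" using S' hull_subset[of S' convex] by (auto simp: W_def)
        then show ?thesis unfolding S'(2) by (rule hull_mono)
      qed
      show "convex hull W \<subseteq> T"
        unfolding W_def using face_of_imp_convex[OF T(1)] by (intro hull_minimal) auto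
    qed
    have dimW: "aff_dim W = 1" using T(2) W aff_dim_convex_hull by metis
    have "card W \<ge> 2"
      using aff_dim_le_card[of W] dimW by (simp add: W_def)
    have "W = {a, b} \<or> W = {a, c} \<or> W = {b, d} \<or> W = {c, d}" (is ?X)
    proof -
      note \<open>card W \<ge> 2\<close>
      moreover have "\<not> {a, b, c, d} \<subseteq> W"
      proof
        assume "{a, b, c, d} \<subseteq> W"
        then have "W = {a, b, c, d}" by (auto simp: W_def)
        then show False using dim dimW by simp
      qed
      moreover have "{a, d} \<subseteq> W \<longleftrightarrow> {a, b, c, d} \<subseteq> W" "{b, c} \<subseteq> W \<longleftrightarrow> {a, b, c, d} \<subseteq> W"
      proof -
        \<comment> \<open>The diagonals cross, since d + k a = c + k b. A supporting functional that
          is minimal at both ends of one diagonal is therefore minimal at both ends of the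
          other.\<close>
        have rel: "v \<bullet> d - e + k * (v \<bullet> a - e) = (v \<bullet> c - e) + k * (v \<bullet> b - e)"
          unfolding d by (simp add: algebra_simps)
        have nonneg: "v \<bullet> b - e \<ge> 0" "v \<bullet> c - e \<ge> 0" "v \<bullet> a - e \<ge> 0" "v \<bullet> d - e \<ge> 0"
          using v(1) by simp_all
        have "v \<bullet> b - e = 0 \<and> v \<bullet> c - e = 0 \<longleftrightarrow> v \<bullet> c - e + k * (v \<bullet> b - e) = 0"
          using nonneg k by (auto simp: add_nonneg_eq_0_iff)
        moreover have "v \<bullet> a - e = 0 \<and> v \<bullet> d - e = 0 \<longleftrightarrow> v \<bullet> d - e + k * (v \<bullet> a - e) = 0"
          using nonneg k by (auto simp: add_nonneg_eq_0_iff)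
        ultimately have iff: "v \<bullet> b = e \<and> v \<bullet> c = e \<longleftrightarrow> v \<bullet> a = e \<and> v \<bullet> d = e"
          using rel by simp
        have memW: "x \<in> W \<longleftrightarrow> v \<bullet> x = e" if "x \<in> {a, b, c, d}" for x
          using v(2)[OF that] that by (simp add: W_def)
        show "{a, d} \<subseteq> W \<longleftrightarrow> {a, b, c, d} \<subseteq> W" "{b, c} \<subseteq> W \<longleftrightarrow> {a, b, c, d} \<subseteq> W"
          using iff memW[of a] memW[of b] memW[of c] memW[of d] by auto
      qed
      moreover obtain p q where "p \<noteq> q" "p \<in> W" "q \<in> W"
      proof -
        obtain W' where "W' \<subseteq> W" "card W' = 2"
          using \<open>card W \<ge> 2\<close> by (meson obtain_subset_with_card_n)
        then show thesis using that by (auto simp: card_2_iff)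
      qed
      moreover have "W \<subseteq> {a, b, c, d}" by (auto simp: W_def)
      ultimately show ?X
        by (cases "a \<in> W"; cases "b \<in> W"; cases "c \<in> W"; cases "d \<in> W") (simp_all, blast+)
    qed
    then show "T \<in> {convex hull {a, b}, convex hull {a, c}, convex hull {b, d}, convex hull {c, d}}"
      using W by auto
  next
    fix T assume "T \<in> {convex hull {a, b}, convex hull {a, c}, convex hull {b, d}, convex hull {c, d}}"
    moreover have "convex hull {a, b} facet_of convex hull {a, b, c, d}"
    proof -
      obtain v where v: "v \<bullet> (b - a) = 0" "v \<bullet> (c - a) = 1" using ex by blast
      then have "v \<bullet> b = v \<bullet> a" "v \<bullet> c = v \<bullet> a + 1" "v \<bullet> d = v \<bullet> a + 1"
        unfolding d by (auto simp: inner_simps)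
      then show ?thesis
        using ne cd bd k by (intro side[of "v \<bullet> a" v]) auto
    qed
    moreover have "convex hull {c, d} facet_of convex hull {a, b, c, d}"
    proof -
      obtain v where v: "v \<bullet> (b - a) = 0" "v \<bullet> (c - a) = -1" using ex by blast
      then have "v \<bullet> b = v \<bullet> c + 1" "v \<bullet> a = v \<bullet> c + 1" "v \<bullet> d = v \<bullet> c"
        unfolding d by (auto simp: inner_simps)
      then show ?thesis
        using ne cd bd k by (intro side[of "v \<bullet> c" v]) auto
    qed
    moreover have "convex hull {a, c} facet_of convex hull {a, b, c, d}"
    proof -
      obtain v where v: "v \<bullet> (b - a) = 1" "v \<bullet> (c - a) = 0" using ex by blast
      then have "v \<bullet> b = v \<bullet> a + 1" "v \<bullet> c = v \<bullet> a" "v \<bullet> d = v \<bullet> a + k"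
        unfolding d by (auto simp: inner_simps)
      then show ?thesis
        using ne cd bd k by (intro side[of "v \<bullet> a" v]) auto
    qed
    moreover have "convex hull {b, d} facet_of convex hull {a, b, c, d}"
    proof -
      \<comment> \<open>The value k - 1 is chosen so that b and d = c + k (b - a) become
        level.\<close>
      obtain v where v: "v \<bullet> (b - a) = -1" "v \<bullet> (c - a) = k - 1" using ex by blast
      then have "v \<bullet> a = v \<bullet> b + 1" "v \<bullet> c = v \<bullet> b + k" "v \<bullet> d = v \<bullet> b"
        unfolding d by (auto simp: inner_simps)
      then show ?thesis
        using ne cd bd k by (intro side[of "v \<bullet> b" v]) auto
    qed
    ultimately show "T \<in> {T. T facet_of convex hull {a, b, c, d}}" by auto
  qed
qed

lemma multiplex_trapezoid:
  fixes a b c d :: "'a::euclidean_space"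
  assumes indep: "\<not> affine_dependent {a, b, c}" and ne: "a \<noteq> b" "a \<noteq> c" "b \<noteq> c"
    and k: "k > 0" and d: "d = c + k *\<^sub>R (b - a)"
    and ord: "vertex_ordering (convex hull {a, b, c, d}) [a, b, c, d]"
  shows "multiplex (convex hull {a, b, c, d}) [a, b, c, d]"
proof -
  have "aff_dim {a, b, c, d} = 2" by (rule aff_dim_trapezoid[OF indep ne d])
  moreover have "{0..<4} = {0, 1, 2, 3::int}" by auto
  ultimately have "multiplex_of_dim 2 (convex hull {a, b, c, d}) [a, b, c, d]"
    using ord facets_trapezoid[OF indep ne k d]
    by (simp add: multiplex_of_dim_def multiplex_facet_2 aff_dim_convex_hull clamped_nth_def polytope_convex_hull)
  then show ?thesis by (auto simp: multiplex_def)
qed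

text \<open>F_2 omits just the middle vertex and is the trapezoid. At the other four positions
  clamping leaves three distinct vertices, namely the apex and one side.\<close>

lemma multiplex_pyramid_trapezoid:
  fixes a b c d p :: "'a::euclidean_space"
  assumes indep: "\<not> affine_dependent {a, b, c}" and ne: "a \<noteq> b" "a \<noteq> c" "b \<noteq> c"
    and k: "k > 0" and d: "d = c + k *\<^sub>R (b - a)" and p: "p \<notin> affine hull {a, b, c}"
    and ord: "vertex_ordering (convex hull {a, b, p, c, d}) [a, b, p, c, d]"
  shows "multiplex (convex hull {a, b, p, c, d}) [a, b, p, c, d]"
proof -
  have dim: "aff_dim {a, b, c, d} = 2" by (rule aff_dim_trapezoid[OF indep ne d])
  have eq: "{a, b, p, c, d} = insert p {a, b, c, d}" by auto
  have p': "p \<notin> affine hull {a, b, c, d}" using p trapezoid_in_plane[OF d] by simp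
  have dimP: "aff_dim {a, b, p, c, d} = 3"
    unfolding eq using p' dim by (simp add: aff_dim_insert)
  have ins: "convex hull (insert p (convex hull T)) = convex hull (insert p T)" for T
    by (rule hull_insert[symmetric])
  have "{T. T facet_of convex hull {a, b, p, c, d}} = {convex hull {a, b, c, d}, convex hull {p, a, b},
      convex hull {p, a, c}, convex hull {p, b, d}, convex hull {p, c, d}}"
    unfolding eq using facets_pyramid[OF _ p'] dim
    by (simp add: facets_trapezoid[OF indep ne k d] ins)
  moreover have "{0..<5} = {0, 1, 2, 3, 4::int}" by auto
  ultimately have "multiplex_of_dim 3 (convex hull {a, b, p, c, d}) [a, b, p, c, d]"
    using ord dimP
    by (simp add: multiplex_of_dim_def multiplex_facet_3 aff_dim_convex_hull clamped_nth_def
        polytope_convex_hull insert_commute)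
  then show ?thesis by (auto simp: multiplex_def)
qed

section \<open>Zero sets of nonnegative sequences with periodic weighted increments\<close>

lemma three_steps:
  fixes f g :: "nat \<Rightarrow> real"
  assumes step: "\<And>k. f (Suc k) = f k + (real k + 1) * g k"
  shows "f (k + 3) = f k + (real k + 1) * g k + (real k + 2) * g (k + 1) + (real k + 3) * g (k + 2)"
  using step[of k] step[of "k + 1"] step[of "k + 2"] by (simp add: eval_nat_numeral algebra_simps)

text \<open>Along a residue class modulo 3 the weights grow by 3 while \<open>g\<close> repeats, so
  the second difference is constant and \<open>f\<close> is quadratic.\<close>

lemma three_step_unroll:
  fixes f g :: "nat \<Rightarrow> real"
  assumes step: "\<And>k. f (Suc k) = f k + (real k + 1) * g k"
    and per: "\<And>k. g (k + 3) = g k"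
  shows "f (k + 3 * t) = f k + real t * (f (k + 3) - f k)
    + 3 * (g k + g (k + 1) + g (k + 2)) * (real t * (real t - 1) / 2)"
proof (induction t)
  case 0
  then show ?case by simp
next
  case (Suc t)
  have per': "g (k + 3 * t + i) = g (k + i)" for i
  proof (induction t)
    case (Suc t)
    then show ?case using per[of "k + 3 * t + i"] by (simp add: algebra_simps)
  qed simp
  note three = three_steps[where f = f and g = g, OF step]
  have "f (k + 3 * Suc t) = f (k + 3 * t + 3)" by (simp add: algebra_simps)
  also have "\<dots> = f (k + 3 * t) + (real (k + 3 * t) + 1) * g k + (real (k + 3 * t) + 2) * g (k + 1)
      + (real (k + 3 * t) + 3) * g (k + 2)"
    using three[of "k + 3 * t"] per'[of 0] per'[of 1] per'[of 2] by simp
  finally show ?case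
    unfolding Suc.IH three[of k] by (simp add: field_simps)
qed

text \<open>The reason is convexity along residue classes modulo 3. The second difference there is 3
  G, with G the sum of \<open>g\<close> over a period; the values at k - 3, k and k + 3 make it
  nonnegative, and sign conditions exclude zero. So f (k + 3 t) > 0 for t >= 2, and the other
  residues are reached from there by steps of known sign.\<close>

lemma zeros_within_four:
  fixes f g :: "nat \<Rightarrow> real"
  assumes step: "\<And>k. f (Suc k) = f k + (real k + 1) * g k"
    and per: "\<And>k. g (k + 3) = g k"
    and nonneg: "\<And>k. k \<le> n \<Longrightarrow> 0 \<le> f k"
    and nz: "g 0 \<noteq> 0 \<or> g 1 \<noteq> 0 \<or> g 2 \<noteq> 0"
    and k: "f k = 0" and l: "l \<le> n" "k + 5 \<le> l"
  shows "f l > 0"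
proof -
  note three = three_steps[where f = f and g = g, OF step]
  have nzk: "g k \<noteq> 0 \<or> g (k + 1) \<noteq> 0 \<or> g (k + 2) \<noteq> 0"
  proof (induction k)
    case (Suc k)
    then show ?case using per[of k] by (auto simp: eval_nat_numeral)
  qed (use nz in \<open>simp add: eval_nat_numeral\<close>)
  define p s r where "p = g k" and "s = g (k + 1)" and "r = - g (k + 2)"
  define G where "G = p + s - r"
  have p0: "p \<ge> 0"
    using nonneg[of "k + 1"] step[of k] k l by (simp add: p_def zero_le_mult_iff)
  have D: "(real k + 1) * p + (real k + 2) * s - (real k + 3) * r \<ge> 0"
    using nonneg[of "k + 3"] three[of k] k l by (simp add: p_def s_def r_def)
  \<comment> \<open>This is \<open>f (k - 3)\<close>, where the recursion extends \<open>f\<close> to negative arguments if \<open>k < 3\<close>.\<close>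
  have E: "k * r - (real k - 1) * s - (real k - 2) * p \<ge> 0"
  proof -
    have "k = 0 \<or> k = 1 \<or> k = 2 \<or> (\<exists>j. k = j + 3)" by presburger
    then consider "k = 0" | "k = 1" | "k = 2" | j where "k = j + 3" by blast
    then show ?thesis
    proof cases
      case 1
      have "f 2 = f 0 + g 0 + 2 * g 1" using step[of 0] step[of 1] by (simp add: eval_nat_numeral)
      then have "p + 2 * s \<ge> 0" using nonneg[of 2] l k 1 by (simp add: p_def s_def)
      then show ?thesis using 1 p0 by simp
    next
      case 2
      have "f 0 = f 1 - g 0" "f 2 = f 1 + 2 * g 1" "g 3 = g 0"
        using step[of 0] step[of 1] per[of 0] by (simp_all add: eval_nat_numeral)
      then show ?thesis using nonneg[of 0] nonneg[of 2] l k 2 by (simp add: p_def s_def r_def eval_nat_numeral)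
    next
      case 3
      have "f 0 = f 2 - g 0 - 2 * g 1" "g 3 = g 0" "g 4 = g 1"
        using step[of 0] step[of 1] per[of 0] per[of 1] by (simp_all add: eval_nat_numeral)
      then show ?thesis using nonneg[of 0] l k 3 by (simp add: p_def s_def r_def eval_nat_numeral)
    next
      case 4
      have "g (k + 2) = g (j + 2)" "g (k + 1) = g (j + 1)" "g k = g j"
        using per[of "j + 2"] per[of "j + 1"] per[of j] 4 by (simp_all add: algebra_simps)
      then show ?thesis using nonneg[of j] three[of j] k l 4 by (simp add: p_def s_def r_def algebra_simps)
    qed
  qed
  \<comment> \<open>The summands are the values three steps ahead and three steps back; as f k = 0,
    their sum is the second difference.\<close>
  have "3 * G = ((real k + 1) * p + (real k + 2) * s - (real k + 3) * r) + (k * r - (real k - 1) * s - (real k - 2) * p)"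
    by (simp add: G_def algebra_simps)
  then have G0: "G \<ge> 0" using D E by linarith
  have rsign: "r \<ge> 0" if kpos: "k > 0"
  proof -
    obtain j where j: "k = Suc j" using kpos by (cases k) auto
    have "f k = f j + (real j + 1) * g j" "g j = g (k + 2)"
      using step[of j] per[of j] j by (simp_all add: eval_nat_numeral)
    then have "(real j + 1) * r \<ge> 0" using nonneg[of j] k l j by (simp add: r_def)
    then show ?thesis by (simp add: zero_le_mult_iff)
  qed
  have ps: "p + 2 * s \<ge> 0" if "k = 0"
  proof -
    have "f 2 = f 0 + g 0 + 2 * g 1" using step[of 0] step[of 1] by (simp add: eval_nat_numeral)
    then show "p + 2 * s \<ge> 0" using nonneg[of 2] l k that by (simp add: p_def s_def)
  qed
  have Gpos: "G > 0"
  proof (rule ccontr)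
    assume "\<not> G > 0"
    then have G: "G = 0" using G0 by simp
    with \<open>3 * G = _\<close> D E have z: "(real k + 1) * p + (real k + 2) * s - (real k + 3) * r = 0" by linarith
    have s: "s = r - p" using G by (simp add: G_def)
    \<comment> \<open>Both summands vanish, which leaves p : s : r = 1 : -2 : -1. The sign of
      \<open>r\<close> for k > 0, or f 2 >= 0 for k = 0, then gives p = 0.\<close>
    have "r + p = 0" using z unfolding s by (simp add: algebra_simps)
    then have "r = - p" "s = - 2 * p" using s by auto
    moreover have "p = 0"
    proof (cases "k = 0")
      case True
      then show ?thesis using ps p0 \<open>s = - 2 * p\<close> by simp
    next
      case False
      then show ?thesis using rsign p0 \<open>r = - p\<close> by simp
    qed
    ultimately show False using nzk by (simp add: p_def s_def r_def)
  qed
  have mult3: "f (k + 3 * t) \<ge> 3 * G * (real t * (real t - 1) / 2)" for t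
  proof -
    have "f (k + 3) \<ge> 0" using nonneg l by simp
    then show ?thesis
      using three_step_unroll[OF step per, of k t] k by (simp add: G_def p_def s_def r_def)
  qed
  have pos3: "f (k + 3 * t) > 0" if "t \<ge> 2" for t
  proof -
    have "3 * G * (real t * (real t - 1) / 2) > 0" using that Gpos by simp
    then show ?thesis using mult3[of t] by linarith
  qed
  have per': "g (k + 3 * t + i) = g (k + i)" for t i
  proof (induction t)
    case (Suc t)
    then show ?case using per[of "k + 3 * t + i"] by (simp add: algebra_simps)
  qed simp
  obtain t where "l = k + 3 * t \<or> l = k + 3 * t + 1 \<or> l = k + 3 * t + 2"
  proof -
    have "l = k + 3 * ((l - k) div 3) \<or> l = k + 3 * ((l - k) div 3) + 1 \<or> l = k + 3 * ((l - k) div 3) + 2"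
      using l by presburger
    then show thesis using that by blast
  qed
  then consider "l = k + 3 * t" "t \<ge> 2" | "l = k + 3 * t + 1" "t \<ge> 2" | "l = k + 3 * t + 2" "t \<ge> 1"
    using l by fastforce
  then show ?thesis
  proof cases
    case 1
    then show ?thesis using pos3 by simp
  next
    case 2
    have "f l = f (k + 3 * t) + (real (k + 3 * t) + 1) * p"
      using step[of "k + 3 * t"] per'[of t 0] 2 by (simp add: p_def)
    moreover have "(real (k + 3 * t) + 1) * p \<ge> 0" using p0 by simp
    ultimately show ?thesis using pos3 2 by (metis add_pos_nonneg)
  next
    case 3
    show ?thesis
    proof (cases "r \<ge> 0")
      case True
      have "k + 3 * Suc t = Suc l" using 3 by simp
      then have "f (k + 3 * Suc t) = f l - (real l + 1) * r"
        using step[of l] per'[of t 2] 3 by (simp only:) (simp add: r_def)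
      moreover have "(real l + 1) * r \<ge> 0" using True by simp
      moreover have "f (k + 3 * Suc t) > 0" using 3 by (intro pos3) simp
      ultimately show ?thesis by linarith
    next
      case False
      \<comment> \<open>A negative \<open>r\<close> spoils the step back from
        \<open>k + 3 * Suc t\<close>, but it forces k = 0. Then one goes forward from
        \<open>f (3 * t)\<close>: the two steps together are nonnegative because f 1 and f 2
        are.\<close>
      then have k0: "k = 0" using rsign by auto
      have fl: "f l = f (3 * t) + (real (3 * t) + 1) * p + (real (3 * t) + 2) * s"
        using step[of "3 * t"] step[of "3 * t + 1"] per'[of t 0] per'[of t 1] 3 k0
        by (simp add: p_def s_def)
      have "2 * ((real (3 * t) + 1) * p + (real (3 * t) + 2) * s) = real (3 * t) * p + (real (3 * t) + 2) * (p + 2 * s)"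
        by (simp add: algebra_simps)
      moreover have "(real (3 * t) + 2) * (p + 2 * s) \<ge> 0" "real (3 * t) * p \<ge> 0" using ps[OF k0] p0 by simp_all
      ultimately have ge: "2 * ((real (3 * t) + 1) * p + (real (3 * t) + 2) * s) \<ge> 0"
        "2 * ((real (3 * t) + 1) * p + (real (3 * t) + 2) * s) = 0 \<Longrightarrow> p = 0 \<and> s = 0"
        using 3 by (auto simp: add_nonneg_eq_0_iff)
      have f3: "f (3 * t) \<ge> 0" using nonneg[of "3 * t"] 3 k0 l by simp
      show ?thesis
      proof (rule ccontr)
        assume "\<not> f l > 0"
        define X where "X = (real (3 * t) + 1) * p + (real (3 * t) + 2) * s"
        have "f l = f (3 * t) + X" "X \<ge> 0" using fl ge(1) by (simp_all add: X_def)
        then have "f (3 * t) = 0" "X = 0" using f3 \<open>\<not> f l > 0\<close> by linarith+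
        then have z: "f (3 * t) = 0" "2 * ((real (3 * t) + 1) * p + (real (3 * t) + 2) * s) = 0"
          by (simp_all add: X_def)
        then have "p = 0" "s = 0" using ge by auto
        then have "f 3 = 3 * G"
          using three[of 0] k k0 by (simp add: G_def p_def s_def r_def eval_nat_numeral)
        moreover have "f (3 * t) = real t * f 3 + 3 * G * (real t * (real t - 1) / 2)"
          using three_step_unroll[OF step per, of 0 t] k k0
          by (simp add: G_def p_def s_def r_def eval_nat_numeral)
        moreover have "3 * G * (real t * (real t - 1) / 2) \<ge> 0" "real t * (3 * G) > 0"
          using 3 Gpos by simp_all
        ultimately show False using z(1) by simp
      qed
    qed
  qed
qed

text \<open>The positions \<open>i - 2, i - 1, i + 1, i + 2\<close>, clamped to \<open>0, \<dots>, n\<close>; the clamping reaches \<open>i\<close> itself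
  only for \<open>i = 0\<close> and \<open>i = n\<close>.\<close>

definition facet_idx :: "nat \<Rightarrow> nat \<Rightarrow> nat set" where
  "facet_idx n i = {k. k \<le> n \<and>
     (k + 2 = i \<or> k + 1 = i \<or> k = i + 1 \<or> k = i + 2 \<or> k = i \<and> (i = 0 \<or> i = n))}"

text \<open>From the least zero k on, only the increments at k, k + 1, k + 2 and again at k matter.
  A third zero makes one of them vanish, and this determines the whole pattern: a trapezoid in
  general, a triangle where 0 or n cuts it off.\<close>

lemma zero_set_classification:
  fixes f g :: "nat \<Rightarrow> real"
  assumes step: "\<And>k. f (Suc k) = f k + (real k + 1) * g k"
    and per: "\<And>k. g (k + 3) = g k"
    and nonneg: "\<And>k. k \<le> n \<Longrightarrow> 0 \<le> f k"
    and nz: "g 0 \<noteq> 0 \<or> g 1 \<noteq> 0 \<or> g 2 \<noteq> 0"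
    and n: "3 \<le> n"
  shows "(\<exists>a b. a < b \<and> b \<le> a + 3 \<and> {k. k \<le> n \<and> f k = 0} \<subseteq> {a, b}) \<or>
    (\<exists>i\<le>n. {k. k \<le> n \<and> f k = 0} = facet_idx n i)"
proof (cases "{k. k \<le> n \<and> f k = 0} = {}")
  case True
  show ?thesis unfolding True by (intro disjI1 exI[of _ 0] exI[of _ 1]) simp
next
  case False
  define k where "k = Min {k. k \<le> n \<and> f k = 0}"
  have "k \<in> {k. k \<le> n \<and> f k = 0}" unfolding k_def using False by (rule Min_in[rotated]) simp
  then have k: "k \<le> n" "f k = 0" by auto
  have kmin: "k \<le> l" if "l \<le> n" "f l = 0" for l unfolding k_def using that by (intro Min_le) auto
  have kmax: "l \<le> k + 4" if "l \<le> n" "f l = 0" for l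
    using zeros_within_four[OF step per nonneg nz k(2), where l = l] that by (cases "k + 5 \<le> l") auto
  have f1: "f (k + 1) = (real k + 1) * g k" using step[of k] k by simp
  have f2: "f (k + 2) = f (k + 1) + (real k + 2) * g (k + 1)" using step[of "k + 1"] by (simp add: algebra_simps)
  have f3: "f (k + 3) = f (k + 2) + (real k + 3) * g (k + 2)"
    using step[of "k + 2"] by (simp add: eval_nat_numeral algebra_simps)
  have f4: "f (k + 4) = f (k + 3) + (real k + 4) * g k"
    using step[of "k + 3"] per[of k] by (simp add: eval_nat_numeral algebra_simps)
  have nzk: "g k \<noteq> 0 \<or> g (k + 1) \<noteq> 0 \<or> g (k + 2) \<noteq> 0"
  proof (induction k)
    case (Suc k)
    then show ?case using per[of k] by (auto simp: eval_nat_numeral)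
  qed (use nz in \<open>simp add: eval_nat_numeral\<close>)
  \<comment> \<open>By minimality \<open>f (k - 1) = - k * g (k - 1)\<close> is positive.\<close>
  have prev: "g (k + 2) < 0" if "k > 0"
  proof -
    obtain j where j: "k = Suc j" using \<open>k > 0\<close> by (cases k) auto
    have "f j \<noteq> 0" using kmin[of j] j k by auto
    then have "f j > 0" using nonneg[of j] j k by simp
    moreover have "f j + (real j + 1) * g (k + 2) = 0"
      using step[of j] per[of j] j k by (simp add: eval_nat_numeral)
    ultimately have "(real j + 1) * g (k + 2) < 0" by linarith
    then show ?thesis by (simp add: mult_less_0_iff)
  qed
  have gk: "g k \<ge> 0" if "k + 1 \<le> n"
    using nonneg[OF that] f1 by (simp add: zero_le_mult_iff)
  let ?Z = "{k. k \<le> n \<and> f k = 0}"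
  have five: "j = k \<or> j = k + 1 \<or> j = k + 2 \<or> j = k + 3 \<or> j = k + 4" if "k \<le> j" "j \<le> k + 4" for j
    using that by linarith
  have sub: "?Z \<subseteq> {k, k + 1, k + 2, k + 3, k + 4}" using kmin kmax five by blast
  consider (A) "k + 4 \<le> n" "f (k + 4) = 0"
    | (B) "\<not> (k + 4 \<le> n \<and> f (k + 4) = 0)" "k + 3 \<le> n" "f (k + 3) = 0"
    | (C) "\<not> (k + 4 \<le> n \<and> f (k + 4) = 0)" "\<not> (k + 3 \<le> n \<and> f (k + 3) = 0)" by blast
  then show ?thesis
  proof cases
    case A
    \<comment> \<open>The increment at k + 3 equals \<open>g k\<close>, which is nonnegative. A zero
      at k + 4 thus forces zeros at k + 3 and k + 1.\<close>
    have "f (k + 3) \<ge> 0" "(real k + 4) * g k \<ge> 0" using nonneg[of "k + 3"] gk A by simp_all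
    then have z: "f (k + 3) = 0" "g k = 0" using f4 A by (auto simp: add_nonneg_eq_0_iff)
    then have f10: "f (k + 1) = 0" using f1 by simp
    have "f (k + 2) \<noteq> 0"
    proof
      assume "f (k + 2) = 0"
      then have "g (k + 1) = 0" "g (k + 2) = 0" using f2 f3 f10 z by auto
      then show False using nzk z by simp
    qed
    then have "?Z = facet_idx n (k + 2)"
      using z f10 k A sub by (auto simp: facet_idx_def eval_nat_numeral)
    then show ?thesis using A by (intro disjI2 exI[of _ "k + 2"]) simp
  next
    case B
    show ?thesis
    proof (cases "f (k + 1) = 0")
      case True
      then have g: "g k = 0" using f1 by simp
      \<comment> \<open>Were k + 4 in range, the same vanishing increment would make it a zero as
        well.\<close>
      then have n: "n = k + 3" using B f4 by (cases "k + 4 \<le> n") auto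
      have "f (k + 2) \<noteq> 0"
      proof
        assume "f (k + 2) = 0"
        then have "g (k + 1) = 0" "g (k + 2) = 0" using f2 f3 True B by auto
        then show False using nzk g by simp
      qed
      then have "?Z = facet_idx n (n - 1)"
        using True k B sub n by (auto simp: facet_idx_def eval_nat_numeral)
      then show ?thesis by (intro disjI2 exI[of _ "n - 1"]) simp
    next
      case f1n: False
      show ?thesis
      proof (cases "f (k + 2) = 0")
        case True
        then have "g (k + 2) = 0" using f3 B by simp
        then have "k = 0" using prev by fastforce
        then have "?Z = facet_idx n 1"
          using True f1n k B sub n by (auto simp: facet_idx_def eval_nat_numeral)
        then show ?thesis using n by (intro disjI2 exI[of _ 1]) simp
      next
        case False
        then have "?Z \<subseteq> {k, k + 3}" using f1n B sub by auto
        then show ?thesis by (intro disjI1 exI[of _ k] exI[of _ "k + 3"]) simp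
      qed
    qed
  next
    case C
    then have sub3: "?Z \<subseteq> {k, k + 1, k + 2}" using sub by auto
    show ?thesis
    proof (cases "k + 2 \<le> n \<and> f (k + 1) = 0 \<and> f (k + 2) = 0")
      case True
      then have g: "g k = 0" "g (k + 1) = 0" using f1 f2 by auto
      show ?thesis
      proof (cases "k = 0")
        case True
        then have "?Z = facet_idx n 0"
          using \<open>k + 2 \<le> n \<and> _\<close> k sub3 n by (auto simp: facet_idx_def eval_nat_numeral)
        then show ?thesis by (intro disjI2 exI[of _ 0]) simp
      next
        case False
        have "\<not> k + 3 \<le> n"
        proof
          assume "k + 3 \<le> n"
          then have "(real k + 3) * g (k + 2) \<ge> 0" using nonneg[of "k + 3"] f3 True by simp
          then show False using prev False by (simp add: zero_le_mult_iff)
        qed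
        then have "n = k + 2" using True by simp
        then have "?Z = facet_idx n n"
          using True k sub3 by (auto simp: facet_idx_def eval_nat_numeral)
        then show ?thesis by (intro disjI2 exI[of _ n]) simp
      qed
    next
      case False
      then have "?Z \<subseteq> {k, k + 1} \<or> ?Z \<subseteq> {k, k + 2}" using sub3 by auto
      then show ?thesis
      proof
        assume "?Z \<subseteq> {k, k + 1}"
        then show ?thesis by (intro disjI1 exI[of _ k] exI[of _ "k + 1"]) simp
      next
        assume "?Z \<subseteq> {k, k + 2}"
        then show ?thesis by (intro disjI1 exI[of _ k] exI[of _ "k + 2"]) simp
      qed
    qed
  qed
qed

section \<open>The base\<close>

definition axis3 :: "nat \<Rightarrow> real^4" where
  "axis3 k = axis (if k mod 3 = 0 then 1 else if k mod 3 = 1 then 2 else 3) 1"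

text \<open>In the index type \<open>4\<close> the numeral 4 equals 0, the one index that
  \<open>axis3\<close> leaves free.\<close>

definition height :: "real^4" where
  "height = axis 4 1"

definition oblong :: "nat \<Rightarrow> real" where
  "oblong k = real k * (real k - 1)"

text \<open>A closed form of the staircase: a step exchanges \<open>oblong k\<close> for
  \<open>oblong (k + 3)\<close> in the direction \<open>axis3 k\<close>, and these differ by 6 (k +
  1).\<close>

definition base_pt :: "nat \<Rightarrow> real^4" where
  "base_pt k = oblong k *\<^sub>R axis3 k + oblong (k + 1) *\<^sub>R axis3 (k + 1) + oblong (k + 2) *\<^sub>R axis3 (k + 2)"

definition top_pt :: "nat \<Rightarrow> real^4" where
  "top_pt j = ((2 * real j + 1)\<^sup>2) *\<^sub>R (axis3 0 + axis3 1 + axis3 2) + (2 * real j + 1) *\<^sub>R height"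

lemma axis3_period: "axis3 (k + 3) = axis3 k"
  by (simp add: axis3_def)

lemma inner_axis3: "axis3 k \<bullet> axis3 l = (if k mod 3 = l mod 3 then 1 else 0)"
proof -
  have "k mod 3 < 3" "l mod 3 < 3" by simp_all
  then show ?thesis by (auto simp: axis3_def inner_axis_axis)
qed

lemma inner_height: "height \<bullet> axis3 k = 0" "axis3 k \<bullet> height = 0" "height \<bullet> height = 1"
  by (simp_all add: axis3_def height_def inner_axis_axis)

lemma axis3_sum: "axis3 k + axis3 (k + 1) + axis3 (k + 2) = axis3 0 + axis3 1 + axis3 2"
proof (induction k)
  case (Suc k)
  have "axis3 (Suc k) + axis3 (Suc k + 1) + axis3 (Suc k + 2) = axis3 k + axis3 (k + 1) + axis3 (k + 2)"
    using axis3_period[of k] by (simp add: eval_nat_numeral algebra_simps)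
  then show ?case using Suc.IH by (rule trans)
qed (simp add: eval_nat_numeral)

lemma base_pt_Suc: "base_pt (Suc k) = base_pt k + (6 * (real k + 1)) *\<^sub>R axis3 k"
proof -
  have "oblong (k + 3) = oblong k + 6 * (real k + 1)"
    by (simp add: oblong_def algebra_simps)
  then show ?thesis
    using axis3_period[of k] by (simp add: base_pt_def eval_nat_numeral algebra_simps)
qed

lemma inner_base_pt:
  "v \<bullet> base_pt k = oblong k * (v \<bullet> axis3 k) + oblong (k + 1) * (v \<bullet> axis3 (k + 1)) + oblong (k + 2) * (v \<bullet> axis3 (k + 2))"
  by (simp add: base_pt_def inner_simps)

lemma axis3_cong: "k mod 3 = l mod 3 \<Longrightarrow> axis3 k = axis3 l"
  by (simp add: axis3_def)

lemma inner_axis3_base_pt: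
  "axis3 k \<bullet> base_pt k = oblong k" "axis3 (k + 1) \<bullet> base_pt k = oblong (k + 1)"
  "axis3 (k + 2) \<bullet> base_pt k = oblong (k + 2)"
proof -
  have "k mod 3 \<noteq> (k + 1) mod 3" "k mod 3 \<noteq> (k + 2) mod 3" "(k + 1) mod 3 \<noteq> (k + 2) mod 3"
    by presburger+
  then show "axis3 k \<bullet> base_pt k = oblong k" "axis3 (k + 1) \<bullet> base_pt k = oblong (k + 1)"
    "axis3 (k + 2) \<bullet> base_pt k = oblong (k + 2)"
    unfolding inner_base_pt inner_axis3 by (auto simp del: mod_Suc_eq)
qed

lemma height_base_pt: "height \<bullet> base_pt k = 0"
  by (simp add: inner_base_pt inner_height)

lemma height_top_pt: "height \<bullet> top_pt j = 2 * real j + 1"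
  by (simp add: top_pt_def inner_simps inner_height)

lemma inner_top_pt:
  "v \<bullet> top_pt j = (2 * real j + 1)\<^sup>2 * (v \<bullet> axis3 k + v \<bullet> axis3 (k + 1) + v \<bullet> axis3 (k + 2))
     + (2 * real j + 1) * (v \<bullet> height)"
  unfolding top_pt_def axis3_sum[of k, symmetric] by (simp add: inner_simps)

text \<open>For 0 < i < n the steps i - 2 and i + 1 are parallel to \<open>axis3 (i + 1)\<close>,
  which therefore gets coefficient 0. The other coefficients balance the steps i - 1 and i, of
  lengths 6 i and 6 (i + 1), so that x_(i-1) and x_(i+1) are level. The coefficients add up to 1,
  but to -1 for i = n, where the base lies on the lower side.\<close>

definition facet_normal :: "nat \<Rightarrow> nat \<Rightarrow> real^4" where
  "facet_normal n i = (if i = n then - axis3 n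
     else (real i + 1) *\<^sub>R axis3 (i + 2) - real i *\<^sub>R axis3 i)"

definition facet_level :: "nat \<Rightarrow> nat \<Rightarrow> real" where
  "facet_level n i = (if i = n then - oblong n else - ((real i + 2) * (real i - 1)))"

text \<open>In the residue classes 1 and 2 of the offset \<open>u\<close> the value is a product of
  two multiples of 3 that differ by 3. It is thus nonnegative, with zeros only at the offsets -2,
  -1, 1, 2. In the class 0 the extra term keeps x_i and x_(i-3) off the plane unless i = 0.\<close>

lemma facet_normal_base_pt:
  assumes "i < n" and k: "int k = int i + u"
  shows "facet_normal n i \<bullet> base_pt k - facet_level n i =
    (if u mod 3 = 0 then 6 * real i * (real k + 1) + of_int (u * (u + 3))
     else if u mod 3 = 1 then of_int ((u - 1) * (u + 2)) else of_int ((u - 2) * (u + 1)))"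
proof -
  have rk: "real k = real i + of_int u" using k by linarith
  have v: "facet_normal n i \<bullet> base_pt k = (real i + 1) * (axis3 (i + 2) \<bullet> base_pt k) - real i * (axis3 i \<bullet> base_pt k)"
    using assms(1) by (simp add: facet_normal_def inner_simps)
  have res: "u mod 3 = (int k - int i) mod 3" using k by simp
  have "u mod 3 = 0 \<or> u mod 3 = 1 \<or> u mod 3 = 2" by presburger
  then consider "u mod 3 = 0" | "u mod 3 = 1" | "u mod 3 = 2" by blast
  then show ?thesis
  proof cases
    case 1
    then have "i mod 3 = k mod 3" "(i + 2) mod 3 = (k + 2) mod 3" unfolding res by presburger+
    from this[THEN axis3_cong] show ?thesis
      using 1 assms(1) unfolding v by (simp only: inner_axis3_base_pt) (simp add: facet_level_def oblong_def rk algebra_simps)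
  next
    case 2
    then have "i mod 3 = (k + 2) mod 3" "(i + 2) mod 3 = (k + 1) mod 3" unfolding res by presburger+
    from this[THEN axis3_cong] show ?thesis
      using 2 assms(1) unfolding v by (simp only: inner_axis3_base_pt) (simp add: facet_level_def oblong_def rk algebra_simps)
  next
    case 3
    then have "i mod 3 = (k + 1) mod 3" "(i + 2) mod 3 = k mod 3" unfolding res by presburger+
    from this[THEN axis3_cong] show ?thesis
      using 3 assms(1) unfolding v by (simp only: inner_axis3_base_pt) (simp add: facet_level_def oblong_def rk algebra_simps)
  qed
qed

lemma oblong_mono: "1 \<le> k \<Longrightarrow> k < l \<Longrightarrow> oblong k < oblong l"
  unfolding oblong_def by (intro mult_strict_mono) auto

lemma ge_and_eq_iff:
  fixes x c :: real
  assumes "x - c = of_int z" "0 \<le> z" "z = 0 \<longleftrightarrow> Q"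
  shows "c \<le> x \<and> (x = c \<longleftrightarrow> Q)"
proof -
  have "x = c + of_int z" using assms(1) by simp
  then show ?thesis using assms(2,3) by simp
qed

lemma facet_supporting:
  assumes "i \<le> n" "k \<le> n" "3 \<le> n"
  shows "facet_level n i \<le> facet_normal n i \<bullet> base_pt k"
    "facet_normal n i \<bullet> base_pt k = facet_level n i \<longleftrightarrow> k \<in> facet_idx n i"
proof -
  have "facet_level n i \<le> facet_normal n i \<bullet> base_pt k \<and>
    (facet_normal n i \<bullet> base_pt k = facet_level n i \<longleftrightarrow> k \<in> facet_idx n i)"
  proof (cases "i = n")
    case True
    \<comment> \<open>The coordinate of x_k in the direction \<open>axis3 n\<close> is
      \<open>oblong l\<close>, and l reaches n exactly for the last three points.\<close>
    obtain l where l: "l = k \<or> l = k + 1 \<or> l = k + 2" "n mod 3 = l mod 3"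
      "l = n \<and> n \<le> k + 2 \<or> l < n \<and> k + 2 < n"
    proof (cases "k + 2 < n")
      case True
      have "n mod 3 = k mod 3 \<or> n mod 3 = (k + 1) mod 3 \<or> n mod 3 = (k + 2) mod 3"
      proof -
        have "n mod 3 = 0 \<or> n mod 3 = 1 \<or> n mod 3 = 2" "k mod 3 = 0 \<or> k mod 3 = 1 \<or> k mod 3 = 2"
          by auto
        then show ?thesis by (auto simp: mod_Suc)
      qed
      then show thesis using True that[of k] that[of "k + 1"] that[of "k + 2"] by auto
    next
      case False
      then show thesis using assms(2) by (intro that[of n]) linarith+
    qed
    have lv: "facet_normal n i \<bullet> base_pt k = - oblong l"
      using True axis3_cong[OF l(2)] l(1) by (auto simp: facet_normal_def inner_axis3_base_pt[simplified])
    note l(3)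
    moreover have "oblong l < oblong n" if "l < n"
    \<comment> \<open>Both \<open>oblong 0\<close> and \<open>oblong 1\<close> are 0, so strict
      growth starts only at 1.\<close>
    proof (cases "l = 0")
      case True
      then show ?thesis using assms(3) by (simp add: oblong_def)
    next
      case False
      then show ?thesis using oblong_mono[of l n] that by simp
    qed
    ultimately show ?thesis
      using True lv assms by (auto simp: facet_level_def facet_idx_def)
  next
    case False
    then have i: "i < n" using assms(1) by simp
    define u where "u = int k - int i"
    have u: "int k = int i + u" by (simp add: u_def)
    have m: "u mod 3 = 0 \<or> u mod 3 = 1 \<or> u mod 3 = 2" by presburger
    note val = facet_normal_base_pt[OF i u]
    have nn: "a * (a + 3) \<ge> 0 \<and> (a * (a + 3) = 0 \<longleftrightarrow> a = 0 \<or> a = -3)" if "a \<noteq> -1" "a \<noteq> -2" for a :: int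
    proof (cases "a \<ge> 0")
      case True
      then show ?thesis by simp
    next
      case False
      then have "a \<le> -3" using that by linarith
      then show ?thesis by (auto simp: mult_nonpos_nonpos)
    qed
    from m consider "u mod 3 = 0" | "u mod 3 = 1" | "u mod 3 = 2" by blast
    then show ?thesis
    proof cases
      case 1
      have u_ne: "u \<noteq> -2" "u \<noteq> -1" "u \<noteq> 1" "u \<noteq> 2" using 1 by auto
      from 1 have "u * (u + 3) \<ge> 0" using nn[of u] by presburger
      then have a: "real_of_int (u * (u + 3)) \<ge> 0" by (simp only: of_int_0_le_iff)
      have b: "6 * real i * (real k + 1) \<ge> 0" by simp
      have "6 * real i * (real k + 1) + real_of_int (u * (u + 3)) = 0 \<longleftrightarrow> i = 0 \<and> u * (u + 3) = 0"
        unfolding add_nonneg_eq_0_iff[OF b a] by (simp only: of_int_eq_0_iff) auto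
      also have "\<dots> \<longleftrightarrow> k \<in> facet_idx n i"
        using u_ne i u assms by (auto simp: facet_idx_def)
      finally have iff: "6 * real i * (real k + 1) + real_of_int (u * (u + 3)) = 0 \<longleftrightarrow> k \<in> facet_idx n i" .
      have "facet_normal n i \<bullet> base_pt k - facet_level n i = 6 * real i * (real k + 1) + real_of_int (u * (u + 3))"
        using val 1 by simp
      moreover have "6 * real i * (real k + 1) + real_of_int (u * (u + 3)) \<ge> 0"
        using b a by (rule add_nonneg_nonneg)
      ultimately show ?thesis using iff by linarith
    next
      case 2
      have u_ne: "u \<noteq> -1" "u \<noteq> 0" "u \<noteq> 2" using 2 by auto
      from 2 have "u - 1 \<noteq> -1" "u - 1 \<noteq> -2" by presburger+
      from nn[OF this] have z: "(u - 1) * (u + 2) \<ge> 0" "(u - 1) * (u + 2) = 0 \<longleftrightarrow> u = 1 \<or> u = -2" by (auto simp: add.commute)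
      have "facet_normal n i \<bullet> base_pt k - facet_level n i = of_int ((u - 1) * (u + 2))"
        using val 2 by simp
      moreover have "u = 1 \<or> u = -2 \<longleftrightarrow> k \<in> facet_idx n i"
        using u_ne i u assms by (auto simp: facet_idx_def)
      ultimately show ?thesis using z by (intro ge_and_eq_iff) auto
    next
      case 3
      have u_ne: "u \<noteq> -2" "u \<noteq> 0" "u \<noteq> 1" using 3 by auto
      from 3 have "u - 2 \<noteq> -1" "u - 2 \<noteq> -2" by presburger+
      from nn[OF this] have z: "(u - 2) * (u + 1) \<ge> 0" "(u - 2) * (u + 1) = 0 \<longleftrightarrow> u = 2 \<or> u = -1" by (auto simp: add.commute)
      have "facet_normal n i \<bullet> base_pt k - facet_level n i = of_int ((u - 2) * (u + 1))"
        using val 3 by simp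
      moreover have "u = 2 \<or> u = -1 \<longleftrightarrow> k \<in> facet_idx n i"
        using u_ne i u assms by (auto simp: facet_idx_def)
      ultimately show ?thesis using z by (intro ge_and_eq_iff) auto
    qed
  qed
  then show "facet_level n i \<le> facet_normal n i \<bullet> base_pt k"
    "facet_normal n i \<bullet> base_pt k = facet_level n i \<longleftrightarrow> k \<in> facet_idx n i" by auto
qed

text \<open>This turns an affine functional along the staircase into a sequence of the kind
  classified above.\<close>

lemma base_pt_steps:
  fixes v :: "real^4"
  shows "v \<bullet> base_pt (Suc k) - c = (v \<bullet> base_pt k - c) + (real k + 1) * (6 * (v \<bullet> axis3 k))"
    "6 * (v \<bullet> axis3 (k + 3)) = 6 * (v \<bullet> axis3 k)"
  by (simp_all add: base_pt_Suc axis3_period inner_simps)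

lemma axis_sum_base_pt: "(axis3 0 + axis3 1 + axis3 2) \<bullet> base_pt k = 3 * (real k)\<^sup>2 + 3 * real k + 2"
  unfolding axis3_sum[of k, symmetric]
  using inner_axis3_base_pt[of k] by (simp only: inner_add_left) (simp add: oblong_def algebra_simps power2_eq_square)

lemma axis_sum_top_pt:
  "(axis3 0 + axis3 1 + axis3 2) \<bullet> top_pt j = 3 * (2 * real j + 1)\<^sup>2"
proof -
  have "(axis3 0 + axis3 1 + axis3 2) \<bullet> (axis3 0 + axis3 1 + axis3 2) = 3"
    by (simp add: inner_simps inner_axis3)
  then show ?thesis
    by (simp only: top_pt_def inner_add_right inner_scaleR_right) (simp add: inner_simps inner_height)
qed

lemma base_pt_eq_iff: "base_pt k = base_pt l \<longleftrightarrow> k = l"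
proof
  assume "base_pt k = base_pt l"
  then have "(real k)\<^sup>2 + real k = (real l)\<^sup>2 + real l"
    using axis_sum_base_pt[of k] axis_sum_base_pt[of l] by simp
  then have "(real k - real l) * (real k + real l + 1) = 0"
    by (simp add: algebra_simps power2_eq_square)
  moreover have "real k + real l + 1 \<noteq> 0" by linarith
  ultimately show "k = l" by simp
qed simp

lemma top_pt_eq_iff: "top_pt i = top_pt j \<longleftrightarrow> i = j"
proof -
  have "height \<bullet> top_pt i = height \<bullet> top_pt j \<longleftrightarrow> i = j" by (simp add: height_top_pt)
  then show ?thesis by metis
qed

lemma top_pt_ne_base_pt: "top_pt j \<noteq> base_pt k"
proof -
  have "height \<bullet> top_pt j \<noteq> height \<bullet> base_pt k" by (simp add: height_top_pt height_base_pt)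
  then show ?thesis by metis
qed

section \<open>Affine independence of small sets of vertices\<close>

lemma not_in_affine_hull:
  fixes v :: "'a::euclidean_space"
  assumes "\<And>x. x \<in> S \<Longrightarrow> v \<bullet> x = c" "v \<bullet> p \<noteq> c"
  shows "p \<notin> affine hull S"
proof -
  have "affine hull S \<subseteq> {x. v \<bullet> x = c}"
    using assms(1) by (intro hull_minimal) (auto simp: affine_hyperplane)
  then show ?thesis using assms(2) by auto
qed

text \<open>Three consecutive steps have different directions, so each one leaves a hyperplane,
  given by its own coordinate, that contains all earlier points.\<close>

lemma four_consecutive_independent:
  "\<not> affine_dependent {base_pt k, base_pt (k + 1), base_pt (k + 2), base_pt (k + 3)}"
proof -
  have ne: "k mod 3 \<noteq> (k + 1) mod 3" "k mod 3 \<noteq> (k + 2) mod 3" "(k + 1) mod 3 \<noteq> (k + 2) mod 3"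
    by presburger+
  have s1: "base_pt (k + 1) = base_pt k + (6 * (real k + 1)) *\<^sub>R axis3 k" using base_pt_Suc[of k] by simp
  have s2: "base_pt (k + 2) = base_pt (k + 1) + (6 * (real k + 2)) *\<^sub>R axis3 (k + 1)"
    using base_pt_Suc[of "k + 1"] by (simp add: algebra_simps)
  have s3: "base_pt (k + 3) = base_pt (k + 2) + (6 * (real k + 3)) *\<^sub>R axis3 (k + 2)"
    using base_pt_Suc[of "k + 2"] by (simp add: eval_nat_numeral algebra_simps)
  have "axis3 (k + 1) \<bullet> base_pt (k + 1) = axis3 (k + 1) \<bullet> base_pt k"
    unfolding s1 inner_add_right inner_scaleR_right inner_axis3 using ne by simp
  moreover have "axis3 (k + 1) \<bullet> base_pt (k + 2) \<noteq> axis3 (k + 1) \<bullet> base_pt (k + 1)"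
    unfolding s2 inner_add_right inner_scaleR_right inner_axis3 using ne by simp
  ultimately have "base_pt (k + 2) \<notin> affine hull {base_pt k, base_pt (k + 1)}"
    by (intro not_in_affine_hull[where v = "axis3 (k + 1)" and c = "axis3 (k + 1) \<bullet> base_pt k"]) auto
  then have "\<not> affine_dependent {base_pt (k + 2), base_pt k, base_pt (k + 1)}"
    by (intro affine_independent_insert affine_independent_2)
  moreover have "base_pt (k + 3) \<notin> affine hull {base_pt (k + 2), base_pt k, base_pt (k + 1)}"
  proof -
    have "axis3 (k + 2) \<bullet> base_pt (k + 1) = axis3 (k + 2) \<bullet> base_pt k"
      unfolding s1 inner_add_right inner_scaleR_right inner_axis3 using ne by simp
    moreover have "axis3 (k + 2) \<bullet> base_pt (k + 2) = axis3 (k + 2) \<bullet> base_pt (k + 1)"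
      unfolding s2 inner_add_right inner_scaleR_right inner_axis3 using ne by simp
    moreover have "axis3 (k + 2) \<bullet> base_pt (k + 3) \<noteq> axis3 (k + 2) \<bullet> base_pt (k + 2)"
      unfolding s3 inner_add_right inner_scaleR_right inner_axis3 using ne by simp
    ultimately show ?thesis
      by (intro not_in_affine_hull[where v = "axis3 (k + 2)" and c = "axis3 (k + 2) \<bullet> base_pt k"]) auto
  qed
  ultimately have "\<not> affine_dependent (insert (base_pt (k + 3)) {base_pt (k + 2), base_pt k, base_pt (k + 1)})"
    by (rule affine_independent_insert)
  then show ?thesis by (simp add: insert_commute)
qed

lemma top_pt_notin_affine_hull:
  assumes "S \<subseteq> range base_pt"
  shows "top_pt j \<notin> affine hull S"
  using assms
  by (intro not_in_affine_hull[where v = height and c = 0]) (auto simp: height_base_pt height_top_pt)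

lemma four_consecutive_top_independent:
  "\<not> affine_dependent {top_pt j, base_pt k, base_pt (k + 1), base_pt (k + 2), base_pt (k + 3)}"
  by (rule affine_independent_insert[OF four_consecutive_independent]) (rule top_pt_notin_affine_hull, auto)

text \<open>No line through two base points at distance at most three meets the axis on which the
  top points project.\<close>

lemma two_two_independent:
  assumes "a < b" "b \<le> a + 3" "i \<noteq> j"
  shows "\<not> affine_dependent {top_pt i, top_pt j, base_pt a, base_pt b}"
proof -
  have ind: "\<not> affine_dependent {top_pt j, base_pt a, base_pt b}"
    by (rule affine_independent_subset[OF four_consecutive_top_independent[of j a]]) (use assms in \<open>auto simp: base_pt_eq_iff\<close>)
  have "top_pt i \<notin> affine hull {top_pt j, base_pt a, base_pt b}"
  proof
    assume "top_pt i \<in> affine hull {top_pt j, base_pt a, base_pt b}"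
    then obtain w s t where eq: "top_pt i = w *\<^sub>R top_pt j + s *\<^sub>R base_pt a + t *\<^sub>R base_pt b" and sum: "w + s + t = 1"
      unfolding affine_hull_3 by blast
    have top: "axis3 l \<bullet> top_pt i = axis3 0 \<bullet> top_pt i" for l i
    proof -
      have "axis3 l \<bullet> (axis3 0 + axis3 1 + axis3 2) = 1" for l
      proof -
        have "l mod 3 \<noteq> (l + 1) mod 3" "l mod 3 \<noteq> (l + 2) mod 3" by presburger+
        then show ?thesis
          unfolding axis3_sum[of l, symmetric] inner_add_right inner_axis3 by simp
      qed
      then show ?thesis by (simp add: top_pt_def inner_simps inner_height)
    qed
    define C where "C = axis3 0 \<bullet> top_pt i - w * (axis3 0 \<bullet> top_pt j)"
    \<comment> \<open>The first three coordinates of a top point agree, so those of s x_a + t x_b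
      must agree too. Comparing them in pairs gives s = t = 0.\<close>
    have C: "s * (axis3 l \<bullet> base_pt a) + t * (axis3 l \<bullet> base_pt b) = C" for l
    proof -
      have "axis3 l \<bullet> top_pt i = w * (axis3 l \<bullet> top_pt j) + s * (axis3 l \<bullet> base_pt a) + t * (axis3 l \<bullet> base_pt b)"
        by (subst eq) (simp add: inner_simps)
      then show ?thesis using top[of l i] top[of l j] by (simp add: C_def)
    qed
    note Ca = C[of a, unfolded inner_axis3_base_pt] C[of "a + 1", unfolded inner_axis3_base_pt]
      C[of "a + 2", unfolded inner_axis3_base_pt]
    have p: "axis3 a = axis3 (a + 3)" "axis3 (a + 1) = axis3 (a + 4)" "axis3 (a + 2) = axis3 (a + 5)"
      using axis3_period[of a] axis3_period[of "a + 1"] axis3_period[of "a + 2"] by (simp_all add: eval_nat_numeral)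
    consider "b = a + 1" | "b = a + 2" | "b = a + 3" using assms by linarith
    then have "s = 0 \<and> t = 0"
    proof cases
      case 1
      have v: "axis3 (a + 1) \<bullet> base_pt b = oblong (a + 1)" "axis3 (a + 2) \<bullet> base_pt b = oblong (a + 2)"
        "axis3 a \<bullet> base_pt b = oblong (a + 3)"
        unfolding 1 p(1) using inner_axis3_base_pt[of "a + 1"] by (simp_all add: eval_nat_numeral)
      have "(s + t) * (oblong (a + 2) - oblong (a + 1)) = 0"
        using Ca(2,3) v by (simp add: algebra_simps)
      then have st: "s + t = 0" using oblong_mono[of "a + 1" "a + 2"] by simp
      have "(s + t) * oblong (a + 1) = s * oblong a + t * oblong (a + 3)"
        using Ca(1,2) v by (simp add: algebra_simps)
      then have "t * (oblong (a + 3) - oblong a) = 0"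
        using st by algebra
      moreover have "oblong (a + 3) - oblong a \<noteq> 0" by (simp add: oblong_def algebra_simps)
      ultimately show ?thesis using st by simp
    next
      case 2
      have v: "axis3 (a + 1) \<bullet> base_pt b = oblong (a + 4)" "axis3 (a + 2) \<bullet> base_pt b = oblong (a + 2)"
        "axis3 a \<bullet> base_pt b = oblong (a + 3)"
        unfolding 2 p(1,2) using inner_axis3_base_pt[of "a + 2"] by (simp_all add: eval_nat_numeral)
      have "s * (oblong (a + 1) - oblong a) + t * (oblong (a + 4) - oblong (a + 3)) = 0"
        "s * (oblong (a + 2) - oblong (a + 1)) = t * (oblong (a + 4) - oblong (a + 2))"
        using Ca v by (simp_all add: algebra_simps)
      then have "s * real a + t * (real a + 3) = 0" "s * (real a + 1) = t * (2 * real a + 5)"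
        by (simp_all add: oblong_def algebra_simps)
      moreover from this have "t * ((2 * real a + 5) * real a + (real a + 1) * (real a + 3)) = 0"
        by algebra
      ultimately show ?thesis by (auto simp: add_nonneg_eq_0_iff)
    next
      case 3
      have v: "axis3 (a + 1) \<bullet> base_pt b = oblong (a + 4)" "axis3 (a + 2) \<bullet> base_pt b = oblong (a + 5)"
        "axis3 a \<bullet> base_pt b = oblong (a + 3)"
        unfolding 3 p using inner_axis3_base_pt[of "a + 3"] by (simp_all add: eval_nat_numeral)
      have "s * (oblong (a + 1) - oblong a) + t * (oblong (a + 4) - oblong (a + 3)) = 0"
        "s * (oblong (a + 2) - oblong (a + 1)) + t * (oblong (a + 5) - oblong (a + 4)) = 0"
        using Ca v by (simp_all add: algebra_simps)
      then have "s * real a + t * (real a + 3) = 0" "s * (real a + 1) + t * (real a + 4) = 0"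
        by (simp_all add: oblong_def algebra_simps)
      moreover from this have "t * 3 = 0" by algebra
      ultimately show ?thesis by auto
    qed
    then have "w = 1" "top_pt i = w *\<^sub>R top_pt j" using sum eq by auto
    then show False using assms(3) top_pt_eq_iff by auto
  qed
  then show ?thesis using ind by (rule affine_independent_insert[rotated])
qed

section \<open>Vertices and facets of the base\<close>

lemma facet_idx_separate:
  assumes "k \<le> n" "l \<le> n" "k \<noteq> l" "3 \<le> n"
  shows "\<exists>i\<le>n. k \<in> facet_idx n i \<and> l \<notin> facet_idx n i"
proof -
  have *: ?thesis if "i \<le> n" "k \<in> facet_idx n i" "l \<notin> facet_idx n i" for i using that by blast
  consider "k = 0" | "k = n" | "0 < k" "k < n" using assms by linarith
  then show ?thesis
  proof cases
    case 1
    then consider "l = 1" | "l = 2" | "3 \<le> l" using assms by linarith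
    then show ?thesis
    proof cases
      case 1
      then show ?thesis using \<open>k = 0\<close> assms by (intro *[of 1]) (auto simp: facet_idx_def)
    next
      case 2
      then show ?thesis using \<open>k = 0\<close> assms by (intro *[of 2]) (auto simp: facet_idx_def)
    next
      case 3
      then show ?thesis using \<open>k = 0\<close> assms by (intro *[of 0]) (auto simp: facet_idx_def)
    qed
  next
    case 2
    then consider "l = n - 1" | "l = n - 2" | "l + 3 \<le> n" using assms by linarith
    then show ?thesis
    proof cases
      case 1
      then show ?thesis using \<open>k = n\<close> assms by (intro *[of "n - 1"]) (auto simp: facet_idx_def)
    next
      case 2
      then show ?thesis using \<open>k = n\<close> assms by (intro *[of "n - 2"]) (auto simp: facet_idx_def)
    next
      case 3
      then show ?thesis using \<open>k = n\<close> assms by (intro *[of n]) (auto simp: facet_idx_def)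
    qed
  next
    case 3
    consider "l = 0" "k = 1" | "l = n" "k + 1 = n" | "\<not> (l = 0 \<and> k = 1)" "\<not> (l = n \<and> k + 1 = n)" by blast
    then show ?thesis
    proof cases
      case 1
      then show ?thesis using assms by (intro *[of 3]) (auto simp: facet_idx_def)
    next
      case 2
      then show ?thesis using assms by (intro *[of "n - 3"]) (auto simp: facet_idx_def)
    next
      case c: 3
      show ?thesis
      proof (cases "l \<in> facet_idx n (k - 1)")
        case True
        have "k \<in> facet_idx n (k + 1)" using 3 by (auto simp: facet_idx_def)
        moreover have "l \<notin> facet_idx n (k + 1)"
          using True 3 c assms(3) by (auto simp: facet_idx_def)
        ultimately show ?thesis using 3 by (intro *) auto
      next
        case False
        have "k \<in> facet_idx n (k - 1)" using 3 by (auto simp: facet_idx_def)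
        then show ?thesis using False 3 by (intro *[of "k - 1"]) auto
      qed
    qed
  qed
qed

definition base :: "nat \<Rightarrow> (real^4) set" where
  "base n = convex hull (base_pt ` {..n})"

lemma polytope_base: "polytope (base n)"
  by (simp add: base_def polytope_convex_hull)

text \<open>Every other base point is missed by some F_i through x_k, so the sum of the normals of
  all F_i through x_k is least at x_k alone.\<close>

lemma vertices_base:
  assumes "3 \<le> n"
  shows "vertices (base n) = base_pt ` {..n}"
proof
  show "vertices (base n) \<subseteq> base_pt ` {..n}"
    unfolding base_def by (rule vertices_convex_hull_subset)
  show "base_pt ` {..n} \<subseteq> vertices (base n)"
  proof (rule image_subsetI)
    fix k assume "k \<in> {..n}"
    then have k: "k \<le> n" by simp
    define I where "I = {i. i \<le> n \<and> k \<in> facet_idx n i}"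
    have fin: "finite I" by (simp add: I_def)
    have k_val: "facet_normal n i \<bullet> base_pt k = facet_level n i" if "i \<in> I" for i
      using that facet_supporting(2)[of i n k] assms k by (simp add: I_def)
    have l_val: "facet_level n i \<le> facet_normal n i \<bullet> base_pt l" if "i \<in> I" "l \<le> n" for i l
      using that facet_supporting(1)[of i n l] assms by (simp add: I_def)
    have "(\<Sum>i\<in>I. facet_normal n i) \<bullet> base_pt k < (\<Sum>i\<in>I. facet_normal n i) \<bullet> x"
      if x: "x \<in> base_pt ` {..n}" "x \<noteq> base_pt k" for x
    proof -
      obtain l where l: "l \<le> n" "x = base_pt l" "l \<noteq> k" using x by auto
      obtain i where i: "i \<le> n" "k \<in> facet_idx n i" "l \<notin> facet_idx n i"
        using facet_idx_separate[of k n l] k l assms by auto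
      have "(\<Sum>i\<in>I. facet_normal n i \<bullet> base_pt k) < (\<Sum>i\<in>I. facet_normal n i \<bullet> base_pt l)"
      proof (rule sum_strict_mono_ex1[OF fin])
        show "\<forall>j\<in>I. facet_normal n j \<bullet> base_pt k \<le> facet_normal n j \<bullet> base_pt l"
          using k_val l_val l(1) by simp
        have "i \<in> I" using i by (simp add: I_def)
        moreover from this have "facet_normal n i \<bullet> base_pt k < facet_normal n i \<bullet> base_pt l"
          using k_val[of i] l_val[of i l] facet_supporting(2)[of i n l] i l assms by (simp add: order.strict_iff_order)
        ultimately show "\<exists>j\<in>I. facet_normal n j \<bullet> base_pt k < facet_normal n j \<bullet> base_pt l" by blast
      qed
      then show ?thesis by (simp add: inner_sum_left l(2))
    qed
    then show "base_pt k \<in> vertices (base n)"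
      unfolding base_def using k by (intro vertex_exposed[where v = "\<Sum>i\<in>I. facet_normal n i"]) auto
  qed
qed

lemma aff_dim_base:
  assumes "3 \<le> n"
  shows "aff_dim (base n) = 3"
proof (rule antisym)
  have "base n \<subseteq> {x. height \<bullet> x = 0}"
    unfolding base_def by (intro hull_minimal) (auto simp: height_base_pt convex_hyperplane)
  then have "aff_dim (base n) \<le> aff_dim {x. height \<bullet> x = 0}" by (rule aff_dim_subset)
  also have "\<dots> = 3" using inner_height(3) by (subst aff_dim_hyperplane) auto
  finally show "aff_dim (base n) \<le> 3" .
  have "3 = aff_dim {base_pt 0, base_pt (0 + 1), base_pt (0 + 2), base_pt (0 + 3)}"
    using aff_dim_affine_independent[OF four_consecutive_independent[of 0]] by (simp add: base_pt_eq_iff)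
  also have "\<dots> \<le> aff_dim (base_pt ` {..n})"
    by (rule aff_dim_subset) (use assms in auto)
  finally show "3 \<le> aff_dim (base n)" by (simp add: base_def aff_dim_convex_hull)
qed

text \<open>Four consecutive base points are affinely independent, so three indices in such a window
  give F_i dimension at least 2.\<close>

lemma facet_idx_window:
  assumes "i \<le> n" "3 \<le> n"
  obtains a b c k where "{a, b, c} \<subseteq> facet_idx n i" "a < b" "b < c" "{a, b, c} \<subseteq> {k, k + 1, k + 2, k + 3}"
proof -
  consider "i = 0" | "i = 1" | "i = n" | "2 \<le> i" "i < n" using assms by linarith
  then show thesis
  proof cases
    case 1
    then show thesis using assms by (intro that[of 0 1 2 0]) (auto simp: facet_idx_def)
  next
    case 2
    then show thesis using assms by (intro that[of 0 2 3 0]) (auto simp: facet_idx_def)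
  next
    case 3
    then show thesis using assms by (intro that[of "n - 2" "n - 1" n "n - 2"]) (auto simp: facet_idx_def)
  next
    case 4
    then show thesis using assms by (intro that[of "i - 2" "i - 1" "i + 1" "i - 2"]) (auto simp: facet_idx_def)
  qed
qed

lemma hull_base_points_eq:
  assumes "G face_of base n"
  shows "G = convex hull (base_pt ` {k. k \<le> n \<and> base_pt k \<in> G})"
proof
  obtain S' where S': "S' \<subseteq> base_pt ` {..n}" "G = convex hull S'"
    using face_of_convex_hull_subset[of "base_pt ` {..n}" G] assms
    by (auto simp: base_def finite_imp_compact)
  have "S' \<subseteq> G" unfolding S'(2) by (rule hull_subset)
  then have "S' \<subseteq> base_pt ` {k. k \<le> n \<and> base_pt k \<in> G}" using S'(1) by auto
  then show "G \<subseteq> convex hull (base_pt ` {k. k \<le> n \<and> base_pt k \<in> G})"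
    unfolding S'(2) by (rule hull_mono)
  show "convex hull (base_pt ` {k. k \<le> n \<and> base_pt k \<in> G}) \<subseteq> G"
    using face_of_imp_convex[OF assms] by (intro hull_minimal) auto
qed

lemma functional_zero_imp_const:
  assumes "v \<bullet> axis3 0 = 0" "v \<bullet> axis3 1 = 0" "v \<bullet> axis3 2 = 0"
  shows "v \<bullet> base_pt k = 0"
proof -
  have "v \<bullet> axis3 k = 0" for k
  proof -
    have "k mod 3 = 0 mod 3 \<or> k mod 3 = 1 mod 3 \<or> k mod 3 = 2 mod 3" by auto
    then show ?thesis using assms axis3_cong by metis
  qed
  then show ?thesis by (simp add: inner_base_pt)
qed

lemma functional_zero_set:
  assumes n: "3 \<le> n" and ge: "\<And>k. k \<le> n \<Longrightarrow> c \<le> v \<bullet> base_pt k"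
    and nz: "\<not> (v \<bullet> axis3 0 = 0 \<and> v \<bullet> axis3 1 = 0 \<and> v \<bullet> axis3 2 = 0)"
  shows "(\<exists>a b. a < b \<and> b \<le> a + 3 \<and> {k. k \<le> n \<and> v \<bullet> base_pt k = c} \<subseteq> {a, b}) \<or>
    (\<exists>i\<le>n. {k. k \<le> n \<and> v \<bullet> base_pt k = c} = facet_idx n i)"
  using zero_set_classification[of "\<lambda>k. v \<bullet> base_pt k - c" "\<lambda>k. 6 * (v \<bullet> axis3 k)" n,
      OF base_pt_steps] n ge nz by simp

text \<open>A facet has dimension 2, which rules out the pairs in the classification of zero sets.
  Conversely F_i is exposed by its normal, contains a triangle and misses a vertex.\<close>

lemma facets_base:
  assumes "3 \<le> n"
  shows "{T. T facet_of base n} = (\<lambda>i. convex hull (base_pt ` facet_idx n i)) ` {..n}"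
proof (intro equalityI subsetI)
  fix T assume "T \<in> {T. T facet_of base n}"
  then have T: "T face_of base n" "aff_dim T = 2"
    using aff_dim_base[OF assms] by (auto simp: facet_of_def)
  define K where "K = {k. k \<le> n \<and> base_pt k \<in> T}"
  have TK: "T = convex hull (base_pt ` K)" unfolding K_def by (rule hull_base_points_eq[OF T(1)])
  then have dimK: "aff_dim (base_pt ` K) = 2" using T(2) aff_dim_convex_hull by metis
  have face: "T face_of convex hull (base_pt ` {..n})" using T(1) by (simp add: base_def)
  obtain v c where vc: "\<And>x. x \<in> base_pt ` {..n} \<Longrightarrow> c \<le> v \<bullet> x"
    "\<And>x. x \<in> base_pt ` {..n} \<Longrightarrow> x \<in> T \<longleftrightarrow> v \<bullet> x = c"
    using face_of_convex_hull_imp_exposed[OF finite_imageI[OF finite_atMost] face] by metis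
  have K: "K = {k. k \<le> n \<and> v \<bullet> base_pt k = c}"
    using vc(2) by (auto simp: K_def)
  have "\<not> (v \<bullet> axis3 0 = 0 \<and> v \<bullet> axis3 1 = 0 \<and> v \<bullet> axis3 2 = 0)"
  proof
    assume "v \<bullet> axis3 0 = 0 \<and> v \<bullet> axis3 1 = 0 \<and> v \<bullet> axis3 2 = 0"
    then have "v \<bullet> base_pt k = 0" for k using functional_zero_imp_const by blast
    then have "K = {} \<or> K = {..n}" unfolding K by auto
    moreover have "aff_dim (base_pt ` {..n}) = 3"
      using aff_dim_base[OF assms] by (simp add: base_def aff_dim_convex_hull)
    ultimately show False using dimK by auto
  qed
  then consider a b where "K \<subseteq> {a, b}" | i where "i \<le> n" "K = facet_idx n i"
    using functional_zero_set[OF assms, of c v] vc(1) unfolding K by blast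
  then show "T \<in> (\<lambda>i. convex hull (base_pt ` facet_idx n i)) ` {..n}"
  proof cases
    case 1
    then have "aff_dim (base_pt ` K) \<le> aff_dim {base_pt a, base_pt b}"
      by (intro aff_dim_subset) auto
    then show ?thesis using dimK by (simp split: if_splits)
  next
    case 2
    then show ?thesis using TK by auto
  qed
next
  fix T assume "T \<in> (\<lambda>i. convex hull (base_pt ` facet_idx n i)) ` {..n}"
  then obtain i where i: "i \<le> n" "T = convex hull (base_pt ` facet_idx n i)" by auto
  have "{x \<in> base_pt ` {..n}. facet_normal n i \<bullet> x = facet_level n i} = base_pt ` facet_idx n i"
    using facet_supporting(2)[OF i(1) _ assms] by (auto simp: facet_idx_def)
  then have face: "T face_of base n"
    using face_of_convex_hull_exposed[of "base_pt ` {..n}" "facet_level n i" "facet_normal n i"]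
      facet_supporting(1)[OF i(1) _ assms] by (auto simp: base_def i(2))
  obtain a b c k where abc: "{a, b, c} \<subseteq> facet_idx n i" "a < b" "b < c" "{a, b, c} \<subseteq> {k, k + 1, k + 2, k + 3}"
    using facet_idx_window[OF i(1) assms] .
  have "base_pt ` {a, b, c} \<subseteq> base_pt ` {k, k + 1, k + 2, k + 3}" using abc(4) by (rule image_mono)
  then have "\<not> affine_dependent {base_pt a, base_pt b, base_pt c}"
    using affine_independent_subset[OF four_consecutive_independent[of k]] by simp
  then have "2 = aff_dim {base_pt a, base_pt b, base_pt c}"
    using aff_dim_affine_independent abc by (fastforce simp: base_pt_eq_iff)
  also have "\<dots> \<le> aff_dim (base_pt ` facet_idx n i)"
    by (rule aff_dim_subset) (use abc(1) in auto)
  finally have ge: "2 \<le> aff_dim T" by (simp add: i(2) aff_dim_convex_hull)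
  have "T \<noteq> base n"
  proof
    assume "T = base n"
    then have sub: "base_pt ` {..n} \<subseteq> base_pt ` facet_idx n i"
      using vertices_base[OF assms] vertices_convex_hull_subset[of "base_pt ` facet_idx n i"] i(2) by simp
    have all: "k \<in> facet_idx n i" if "k \<le> n" for k
    proof -
      have "base_pt k \<in> base_pt ` facet_idx n i" using sub that by auto
      then show ?thesis by (auto simp: base_pt_eq_iff)
    qed
    \<comment> \<open>The missing vertex is x_n for i = 0, x_0 for i = n, and x_i otherwise.\<close>
    consider "i = 0" | "i = n" | "0 < i" "i < n" using i(1) by linarith
    then show False
      using all[of i] all[of 0] all[of n] assms by cases (auto simp: facet_idx_def)
  qed
  then have "aff_dim T < 3"
    using face_of_aff_dim_lt[OF _ face] aff_dim_base[OF assms] polytope_base polytope_imp_convex by metis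
  then show "T \<in> {T. T facet_of base n}"
    using ge face aff_dim_base[OF assms] by (auto simp: facet_of_def)
qed

lemma multiplex_facet_base_list:
  assumes "i \<le> n" "3 \<le> n"
  shows "multiplex_facet 3 (map base_pt [0..<Suc n]) (int i) = convex hull (base_pt ` facet_idx n i)"
proof -
  define h where "h j = nat (max 0 (min (int n) j))" for j
  have cl: "clamped_nth (map base_pt [0..<Suc n]) j = base_pt (h j)" for j
  proof -
    have "h j < Suc n" by (auto simp: h_def)
    then show ?thesis
      by (subst clamped_nth_eq) (simp_all add: h_def del: upt_Suc)
  qed
  have h: "h j = (if j < 0 then 0 else if j > int n then n else nat j)" for j
    by (auto simp: h_def)
  have "{h (int i - 2), h (int i - 1), h (int i + 1), h (int i + 2)} = facet_idx n i"
  proof (intro equalityI subsetI)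
    fix k assume "k \<in> {h (int i - 2), h (int i - 1), h (int i + 1), h (int i + 2)}"
    then show "k \<in> facet_idx n i"
      using assms by (auto simp: h facet_idx_def split: if_splits)
  next
    fix k assume "k \<in> facet_idx n i"
    then have "k \<le> n" "k + 2 = i \<or> k + 1 = i \<or> k = i + 1 \<or> k = i + 2 \<or> k = i \<and> (i = 0 \<or> i = n)"
      by (auto simp: facet_idx_def)
    then show "k \<in> {h (int i - 2), h (int i - 1), h (int i + 1), h (int i + 2)}"
      by (elim disjE conjE) (auto simp: h)
  qed
  then have "base_pt ` facet_idx n i =
      {base_pt (h (int i - 2)), base_pt (h (int i - 1)), base_pt (h (int i + 1)), base_pt (h (int i + 2))}"
    by (metis image_empty image_insert)
  then show ?thesis by (simp only: multiplex_facet_3 cl)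
qed

lemma multiplex_base:
  assumes "3 \<le> n"
  shows "multiplex (base n) (map base_pt [0..<Suc n])"
proof -
  have "{0..<int (length (map base_pt [0..<Suc n]))} = int ` {..n}"
    by (auto simp: image_iff intro!: bexI[where x = "nat x" for x])
  then have "multiplex_facet 3 (map base_pt [0..<Suc n]) ` {0..<int (length (map base_pt [0..<Suc n]))}
      = (\<lambda>i. convex hull (base_pt ` facet_idx n i)) ` {..n}"
    using multiplex_facet_base_list[OF _ assms] by (simp add: image_image del: upt_Suc)
  moreover have "vertex_ordering (base n) (map base_pt [0..<Suc n])"
    using vertices_base[OF assms]
    by (auto simp: vertex_ordering_def distinct_map inj_on_def base_pt_eq_iff simp del: upt_Suc)
  ultimately have "multiplex_of_dim 3 (base n) (map base_pt [0..<Suc n])"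
    using facets_base[OF assms] polytope_base aff_dim_base[OF assms] by (simp add: multiplex_of_dim_def del: upt_Suc)
  then show ?thesis by (auto simp: multiplex_def)
qed

section \<open>Functionals on the axis of the top points\<close>

text \<open>By Vieta two roots of G t^2 + s t + G B have product B. This is why a face over F_i,
  including F_0 and F_n, has at most one top point.\<close>

lemma odd_product_no_root_pair:
  fixes G s :: real and i j :: nat and B :: int
  assumes "G \<noteq> 0" "even B" "i \<noteq> j"
    and "(2 * real i + 1)\<^sup>2 * G + (2 * real i + 1) * s + G * of_int B = 0"
    and "(2 * real j + 1)\<^sup>2 * G + (2 * real j + 1) * s + G * of_int B = 0"
  shows False
proof -
  define x y where "x = 2 * real i + 1" and "y = 2 * real j + 1"
  have eqs: "x\<^sup>2 * G + x * s + G * of_int B = 0" "y\<^sup>2 * G + y * s + G * of_int B = 0"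
    using assms(4,5) by (simp_all add: x_def y_def)
  have "x - y \<noteq> 0" using assms(3) by (simp add: x_def y_def)
  moreover have "(x - y) * (G * (x * y - of_int B)) = 0" using eqs by algebra
  ultimately have "x * y = of_int B" using assms(1) by simp
  moreover have "x * y = of_int ((2 * int i + 1) * (2 * int j + 1))" by (simp add: x_def y_def)
  ultimately have "(2 * int i + 1) * (2 * int j + 1) = B" by (metis of_int_eq_iff)
  moreover have "odd ((2 * int i + 1) * (2 * int j + 1))" by simp
  ultimately show False using assms(2) by simp
qed

lemma quadratic_three_roots:
  fixes G s c x y z :: real
  assumes "x\<^sup>2 * G + x * s = c" "y\<^sup>2 * G + y * s = c" "z\<^sup>2 * G + z * s = c" "x \<noteq> y" "x \<noteq> z" "y \<noteq> z"
  shows "G = 0 \<and> s = 0 \<and> c = 0"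
proof -
  have "(x - y) * ((x + y) * G + s) = 0" using assms(1,2) by (simp add: algebra_simps power2_eq_square)
  moreover have "(x - z) * ((x + z) * G + s) = 0" using assms(1,3) by (simp add: algebra_simps power2_eq_square)
  ultimately have 1: "(x + y) * G + s = 0" "(x + z) * G + s = 0" using assms(4,5) by auto
  then have "(y - z) * G = 0" by algebra
  then have "G = 0" using assms(6) by simp
  then show ?thesis using 1 assms(1) by simp
qed

text \<open>The zero set \<open>F\<^sub>i\<close> determines the functional up to the factor \<open>G\<close>, its slope along the axis
  \<open>(z, z, z)\<close>.\<close>

lemma facet_functional:
  assumes n: "3 \<le> n" and i: "i \<le> n"
    and ge: "\<And>k. k \<le> n \<Longrightarrow> c \<le> v \<bullet> base_pt k"
    and zero: "{k. k \<le> n \<and> v \<bullet> base_pt k = c} = facet_idx n i"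
    and G: "G = v \<bullet> axis3 0 + v \<bullet> axis3 1 + v \<bullet> axis3 2"
  shows "i < n \<Longrightarrow> c = - G * ((real i + 2) * (real i - 1))" "i = n \<Longrightarrow> c = G * oblong n"
    "1 \<le> i \<Longrightarrow> i < n \<Longrightarrow> 0 \<le> G"
    "G = 0 \<Longrightarrow> v \<bullet> axis3 0 = 0 \<and> v \<bullet> axis3 1 = 0 \<and> v \<bullet> axis3 2 = 0"
proof -
  have mem: "v \<bullet> base_pt k = c" if "k \<in> facet_idx n i" for k using zero that by blast
  have Gk: "G = v \<bullet> axis3 k + v \<bullet> axis3 (k + 1) + v \<bullet> axis3 (k + 2)" for k
    unfolding G inner_add_right[symmetric] axis3_sum[of k] ..
  have stp: "v \<bullet> axis3 k = 0" if "v \<bullet> base_pt k = c" "v \<bullet> base_pt (Suc k) = c" for k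
    using that by (simp add: base_pt_Suc inner_simps)
  have allzero: "v \<bullet> axis3 0 = 0 \<and> v \<bullet> axis3 1 = 0 \<and> v \<bullet> axis3 2 = 0"
    if "v \<bullet> axis3 k = 0" "v \<bullet> axis3 (k + 1) = 0" "v \<bullet> axis3 (k + 2) = 0" for k
  proof -
    have "v \<bullet> axis3 l = 0" for l
    proof -
      have "k mod 3 = 0 \<or> k mod 3 = 1 \<or> k mod 3 = 2" "l mod 3 = 0 \<or> l mod 3 = 1 \<or> l mod 3 = 2" by auto
      then have "l mod 3 = k mod 3 \<or> l mod 3 = (k + 1) mod 3 \<or> l mod 3 = (k + 2) mod 3"
        by (auto simp: mod_Suc)
      then show ?thesis using that axis3_cong by metis
    qed
    then show ?thesis by blast
  qed
  consider (z) "i = 0" | (l) "i = n" | (m) "1 \<le> i" "i < n" using i by linarith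
  then have "(i < n \<longrightarrow> c = - G * ((real i + 2) * (real i - 1))) \<and> (i = n \<longrightarrow> c = G * oblong n) \<and>
    (1 \<le> i \<and> i < n \<longrightarrow> 0 \<le> G) \<and>
    (G = 0 \<longrightarrow> v \<bullet> axis3 0 = 0 \<and> v \<bullet> axis3 1 = 0 \<and> v \<bullet> axis3 2 = 0)"
  proof cases
    case z
    have "v \<bullet> base_pt 0 = c" "v \<bullet> base_pt 1 = c" "v \<bullet> base_pt 2 = c"
      using z n by (auto intro!: mem simp: facet_idx_def)
    then have a: "v \<bullet> axis3 0 = 0" "v \<bullet> axis3 1 = 0" "v \<bullet> base_pt 0 = c"
      using stp[of 0] stp[of 1] by (simp_all add: eval_nat_numeral)
    have "c = 2 * (v \<bullet> axis3 2)" using a by (simp add: inner_base_pt oblong_def eval_nat_numeral)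
    then show ?thesis using a z n G by simp
  next
    case l
    define k where "k = n - 2"
    have k: "n = k + 2" using n by (simp add: k_def)
    have "v \<bullet> base_pt k = c" "v \<bullet> base_pt (Suc k) = c" "v \<bullet> base_pt (Suc (Suc k)) = c"
      using l k by (auto intro!: mem simp: facet_idx_def)
    then have a: "v \<bullet> axis3 k = 0" "v \<bullet> axis3 (k + 1) = 0" "v \<bullet> base_pt n = c"
      using stp[of k] stp[of "Suc k"] k by (simp_all add: eval_nat_numeral)
    have "axis3 (n + 1) = axis3 k" "axis3 (n + 2) = axis3 (k + 1)"
      using axis3_period[of k] axis3_period[of "k + 1"] k by (simp_all add: eval_nat_numeral)
    then have "c = oblong n * (v \<bullet> axis3 n)" using a inner_base_pt[of v n] by simp
    moreover have Gn: "G = v \<bullet> axis3 n" using Gk[of k] a k by simp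
    ultimately show ?thesis using l allzero[of k] a k by simp
  next
    case m
    define k where "k = i - 1"
    have k: "i = k + 1" using m by (simp add: k_def)
    have b1: "v \<bullet> base_pt k = c" "v \<bullet> base_pt (k + 2) = c"
      using m k by (auto intro!: mem simp: facet_idx_def)
    have z2: "v \<bullet> axis3 (k + 2) = 0"
    proof (cases "i + 2 \<le> n")
      case True
      then have "v \<bullet> base_pt (k + 3) = c" using k by (intro mem) (auto simp: facet_idx_def)
      then show ?thesis using stp[of "k + 2"] b1 by (simp add: eval_nat_numeral)
    next
      case False
      \<comment> \<open>Here i = n - 1 and there is no x_(i+2); the parallel step from x_(i-2) to
        x_(i-1) takes the place of the one from x_(i+1).\<close>
      define j where "j = k - 1"
      have j: "k = Suc j" using False n m k by (simp add: j_def)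
      have "v \<bullet> base_pt j = c" using k j m by (intro mem) (auto simp: facet_idx_def)
      then have "v \<bullet> axis3 j = 0" using stp[of j] b1 j by simp
      then show ?thesis using axis3_period[of j] j by (simp add: eval_nat_numeral)
    qed
    have s1: "v \<bullet> base_pt (k + 1) = c + 6 * (real k + 1) * (v \<bullet> axis3 k)"
      using base_pt_Suc[of k] b1 by (simp add: inner_simps)
    have s2: "c = v \<bullet> base_pt (k + 1) + 6 * (real k + 2) * (v \<bullet> axis3 (k + 1))"
      using base_pt_Suc[of "k + 1"] b1 by (simp add: inner_simps algebra_simps)
    define p where "p = v \<bullet> axis3 k"
    define r where "r = v \<bullet> axis3 (k + 1)"
    \<comment> \<open>That x_(i-1) and x_(i+1) are level fixes the ratio of \<open>p\<close> and
      \<open>r\<close>, and their sum is \<open>G\<close>.\<close>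
    have rel: "(real k + 1) * p + (real k + 2) * r = 0" using s1 s2 by (simp add: p_def r_def algebra_simps)
    have Gpr: "G = p + r" using Gk[of k] z2 by (simp add: p_def r_def)
    have pr: "r = - (real k + 1) * G" "p = (real k + 2) * G" unfolding Gpr using rel by algebra+
    have "c = oblong k * p + oblong (k + 1) * r" using b1(1) z2 by (simp add: inner_base_pt p_def r_def)
    then have c: "c = - G * ((real i + 2) * (real i - 1))"
      unfolding pr k by (simp add: oblong_def algebra_simps)
    have "c \<le> v \<bullet> base_pt (k + 1)" using ge[of "k + 1"] m k by simp
    then have "0 \<le> 6 * (real k + 1) * p" using s1 by (simp add: p_def)
    then have "0 \<le> p" by (simp add: zero_le_mult_iff)
    then have "0 \<le> G" unfolding pr by (simp add: zero_le_mult_iff)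
    moreover have "G = 0 \<longrightarrow> p = 0 \<and> r = 0" using pr by simp
    ultimately show ?thesis using c m allzero[of k] z2 by (auto simp: p_def r_def)
  qed
  then show "i < n \<Longrightarrow> c = - G * ((real i + 2) * (real i - 1))" "i = n \<Longrightarrow> c = G * oblong n"
    "1 \<le> i \<Longrightarrow> i < n \<Longrightarrow> 0 \<le> G"
    "G = 0 \<Longrightarrow> v \<bullet> axis3 0 = 0 \<and> v \<bullet> axis3 1 = 0 \<and> v \<bullet> axis3 2 = 0" by blast+
qed

text \<open>Let x = 2 (i div 2) + 1. Eliminating \<open>s\<close> between the inequality at x and
  the equation at the root y gives G (x - y) (x y - B) >= 0. But B lies strictly between the
  products of x with its two odd neighbours, so for y different from x the two factors have opposite
  signs. The bound on \<open>i\<close> ensures that x belongs to one of the m top points.\<close>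

lemma minimizer_position:
  fixes G s :: real and i j m :: nat
  assumes G: "0 < G" and i: "2 \<le> i" "i \<le> 2 * m + 1"
    and ge: "\<And>l. 1 \<le> l \<Longrightarrow> l \<le> m \<Longrightarrow>
      0 \<le> (2 * real l + 1)\<^sup>2 * G + (2 * real l + 1) * s + G * ((real i + 2) * (real i - 1))"
    and eq: "(2 * real j + 1)\<^sup>2 * G + (2 * real j + 1) * s + G * ((real i + 2) * (real i - 1)) = 0"
  shows "j = i div 2"
proof -
  define l where "l = i div 2"
  define B where "B = (real i + 2) * (real i - 1)"
  define x where "x = 2 * real l + 1"
  define y where "y = 2 * real j + 1"
  have l: "1 \<le> l" "l \<le> m" using i by (auto simp: l_def)
  have ex: "0 \<le> x\<^sup>2 * G + x * s + G * B" using ge[OF l] by (simp add: x_def B_def)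
  have ey: "y\<^sup>2 * G + y * s + G * B = 0" using eq by (simp add: y_def B_def)
  have "y > 0" by (simp add: y_def)
  have "0 \<le> y * (x\<^sup>2 * G + x * s + G * B)" using ex \<open>y > 0\<close> by simp
  also have "\<dots> = G * ((x - y) * (x * y - B))" using ey by algebra
  finally have pos: "0 \<le> (x - y) * (x * y - B)" using G by (simp add: zero_le_mult_iff)
  have il: "2 * real l \<le> real i" "real i \<le> 2 * real l + 1"
  proof -
    have "2 * l \<le> i" "i \<le> 2 * l + 1" unfolding l_def by linarith+
    then show "2 * real l \<le> real i" "real i \<le> 2 * real l + 1" by linarith+
  qed
  \<comment> \<open>The upper bound is the value of B at i = 2 l + 1, the lower bound below its
    value at i = 2 l.\<close>
  have Bup: "B \<le> (2 * real l + 3) * (2 * real l)"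
    unfolding B_def using il i by (intro mult_mono) auto
  have Blo: "(2 * real l + 2) * (2 * real l - 1) \<le> B"
    unfolding B_def using il l by (intro mult_mono) auto
  show ?thesis
  proof (rule ccontr)
    assume "j \<noteq> i div 2"
    then have "l < j \<or> j < l" unfolding l_def by linarith
    then consider "l < j" | "j < l" by blast
    then show False
    proof cases
      case 1
      then have "real j \<ge> real l + 1" by simp
      then have y: "y \<ge> 2 * real l + 3" by (simp add: y_def)
      then have "x * y \<ge> x * (2 * real l + 3)" by (intro mult_left_mono) (auto simp: x_def)
      also have "x * (2 * real l + 3) = (2 * real l + 3) * (2 * real l) + (2 * real l + 3)" by (simp add: x_def algebra_simps)
      finally have "x * y - B > 0" using Bup by linarith
      moreover have "x - y < 0" using y by (simp add: x_def)
      ultimately show False using pos by (simp add: zero_le_mult_iff)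
    next
      case 2
      then have "real j \<le> real l - 1" by simp
      then have y: "y \<le> 2 * real l - 1" by (simp add: y_def)
      then have "x * y \<le> x * (2 * real l - 1)" by (intro mult_left_mono) (auto simp: x_def)
      also have "x * (2 * real l - 1) = (2 * real l + 2) * (2 * real l - 1) - (2 * real l - 1)" by (simp add: x_def algebra_simps)
      finally have "x * y - B < 0" using Blo l by linarith
      moreover have "x - y > 0" using y by (simp add: x_def)
      ultimately show False using pos by (simp add: zero_le_mult_iff)
    qed
  qed
qed

section \<open>The tower over the base\<close>

definition tower_pts :: "nat \<Rightarrow> nat \<Rightarrow> (real^4) set" where
  "tower_pts n m = base_pt ` {..n} \<union> top_pt ` {1..m}"

definition tower :: "nat \<Rightarrow> nat \<Rightarrow> (real^4) set" where
  "tower n m = convex hull (tower_pts n m)"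

lemma finite_tower_pts: "finite (tower_pts n m)"
  by (simp add: tower_pts_def)

lemma polytope_tower: "polytope (tower n m)"
  by (simp add: tower_def polytope_convex_hull finite_tower_pts)

lemma base_face_tower: "base n face_of tower n m"
proof -
  have "{x \<in> tower_pts n m. height \<bullet> x = 0} = base_pt ` {..n}"
    by (auto simp: tower_pts_def height_base_pt height_top_pt)
  moreover have "0 \<le> height \<bullet> x" if "x \<in> tower_pts n m" for x
    using that by (auto simp: tower_pts_def height_base_pt height_top_pt)
  ultimately show ?thesis
    using face_of_convex_hull_exposed[OF finite_tower_pts, of n m 0 height]
    by (simp add: base_def tower_def)
qed

lemma vertices_tower:
  assumes "3 \<le> n"
  shows "vertices (tower n m) = tower_pts n m"
proof
  show "vertices (tower n m) \<subseteq> tower_pts n m"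
    unfolding tower_def by (rule vertices_convex_hull_subset)
  have "base_pt ` {..n} \<subseteq> vertices (tower n m)"
    using vertices_face[OF base_face_tower, of n m] vertices_base[OF assms] by blast
  moreover have "top_pt j \<in> vertices (tower n m)" if j: "j \<in> {1..m}" for j
  proof -
    \<comment> \<open>On the top points this functional is \<open>\<theta>\<^sup>2 - 2 \<theta> \<theta>\<^sub>j = (\<theta> - \<theta>\<^sub>j)\<^sup>2 - \<theta>\<^sub>j\<^sup>2\<close>.\<close>
    define v where "v = (1 / 3) *\<^sub>R (axis3 0 + axis3 1 + axis3 2) - (2 * (2 * real j + 1)) *\<^sub>R height"
    have vt: "v \<bullet> top_pt l = (2 * real l - 2 * real j)\<^sup>2 - (2 * real j + 1)\<^sup>2" for l
      unfolding v_def inner_diff_left inner_scaleR_left axis_sum_top_pt height_top_pt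
      by (simp add: power2_eq_square algebra_simps)
    have vb: "v \<bullet> base_pt k \<ge> 0" for k
      unfolding v_def inner_diff_left inner_scaleR_left axis_sum_base_pt height_base_pt by simp
    have "v \<bullet> top_pt j < v \<bullet> x" if x: "x \<in> tower_pts n m" "x \<noteq> top_pt j" for x
    proof -
      have neg: "v \<bullet> top_pt j < 0" unfolding vt by (simp add: power2_eq_square)
      consider k where "x = base_pt k" | l where "x = top_pt l" "l \<noteq> j"
        using x by (auto simp: tower_pts_def)
      then show ?thesis
      proof cases
        case 1
        then show ?thesis using neg vb[of k] by simp
      next
        case 2
        then show ?thesis by (simp add: vt)
      qed
    qed
    then show ?thesis
      unfolding tower_def using j by (intro vertex_exposed[where v = v] finite_tower_pts) (auto simp: tower_pts_def)
  qed
  ultimately show "tower_pts n m \<subseteq> vertices (tower n m)" by (auto simp: tower_pts_def)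
qed

lemma aff_dim_tower:
  assumes "3 \<le> n" "1 \<le> m"
  shows "aff_dim (tower n m) = 4"
proof (rule antisym)
  show "aff_dim (tower n m) \<le> 4" using aff_dim_le_DIM[of "tower n m"] by simp
  have "{top_pt 1, base_pt 0, base_pt (0 + 1), base_pt (0 + 2), base_pt (0 + 3)} \<subseteq> tower_pts n m"
    using assms by (auto simp: tower_pts_def)
  moreover have "aff_dim {top_pt 1, base_pt 0, base_pt (0 + 1), base_pt (0 + 2), base_pt (0 + 3)} = 4"
    using aff_dim_affine_independent[OF four_consecutive_top_independent[of 1 0]]
    by (simp add: base_pt_eq_iff top_pt_ne_base_pt)
  ultimately show "4 \<le> aff_dim (tower n m)"
    using aff_dim_subset unfolding tower_def aff_dim_convex_hull by metis
qed

lemma card_tower_pts: "card (tower_pts n m) = Suc n + m"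
proof -
  have "card (base_pt ` {..n}) = Suc n" "card (top_pt ` {1..m}) = m"
    by (simp_all add: card_image inj_on_def base_pt_eq_iff top_pt_eq_iff)
  moreover have "base_pt ` {..n} \<inter> top_pt ` {1..m} = {}"
    by (auto simp: top_pt_ne_base_pt[symmetric])
  ultimately show ?thesis by (simp add: tower_pts_def card_Un_disjoint)
qed

section \<open>Vertex sets of the faces of the tower\<close>

lemma quadratic_root_set:
  fixes G s c :: real
  assumes "\<not> (G = 0 \<and> s = 0 \<and> c = 0)"
  shows "\<exists>i j. {l::nat. P l \<and> (2 * real l + 1)\<^sup>2 * G + (2 * real l + 1) * s = c} \<subseteq> {i, j}"
proof (rule ccontr)
  let ?J = "{l::nat. P l \<and> (2 * real l + 1)\<^sup>2 * G + (2 * real l + 1) * s = c}"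
  assume none: "\<nexists>i j. ?J \<subseteq> {i, j}"
  obtain i where i: "i \<in> ?J" using none by blast
  obtain j where j: "j \<in> ?J" "j \<noteq> i" using none by blast
  obtain l where l: "l \<in> ?J" "l \<noteq> i" "l \<noteq> j" using none by blast
  show False
    using quadratic_three_roots[of "2 * real i + 1" G s c "2 * real j + 1" "2 * real l + 1"] i j l assms
    by auto
qed

text \<open>A supporting functional is a classified sequence on the staircase and a quadratic in t =
  2 j + 1 on the top points; the zeros of the former give K, the roots of the latter J. The bound on
  \<open>n\<close> puts i div 2 into 1, ..., m for every trapezoid F_i.\<close>

lemma face_vertex_sets:
  assumes n: "3 \<le> n" and nm: "n \<le> 2 * m + 3"
    and G: "F face_of tower n m" "F \<noteq> tower n m"
    and K: "K = {k. k \<le> n \<and> base_pt k \<in> F}" and J: "J = {j. j \<in> {1..m} \<and> top_pt j \<in> F}"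
  obtains (base) "K = {..n}" "J = {}"
  | (small) a b i j where "a < b" "b \<le> a + 3" "K \<subseteq> {a, b}" "J \<subseteq> {i, j}"
  | (facet) i j where "i \<le> n" "K = facet_idx n i" "J \<subseteq> {j}" "2 \<le> i \<Longrightarrow> i + 2 \<le> n \<Longrightarrow> j = i div 2"
proof -
  obtain v c where ge: "\<And>x. x \<in> tower_pts n m \<Longrightarrow> c \<le> v \<bullet> x"
    and iff: "\<And>x. x \<in> tower_pts n m \<Longrightarrow> x \<in> F \<longleftrightarrow> v \<bullet> x = c"
    using face_of_convex_hull_imp_exposed[OF finite_tower_pts G(1)[unfolded tower_def]] by metis
  define g where "g = v \<bullet> axis3 0 + v \<bullet> axis3 1 + v \<bullet> axis3 2"
  define s where "s = v \<bullet> height"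
  have vt: "v \<bullet> top_pt j = (2 * real j + 1)\<^sup>2 * g + (2 * real j + 1) * s" for j
    using inner_top_pt[of v j 0] by (simp add: g_def s_def eval_nat_numeral)
  have geb: "c \<le> v \<bullet> base_pt k" if "k \<le> n" for k using ge[of "base_pt k"] that by (simp add: tower_pts_def)
  have get: "c \<le> (2 * real j + 1)\<^sup>2 * g + (2 * real j + 1) * s" if "1 \<le> j" "j \<le> m" for j
    using ge[of "top_pt j"] that by (simp add: tower_pts_def vt)
  have Kv: "K = {k. k \<le> n \<and> v \<bullet> base_pt k = c}"
    unfolding K using iff by (auto simp: tower_pts_def)
  have Jv: "J = {j. j \<in> {1..m} \<and> (2 * real j + 1)\<^sup>2 * g + (2 * real j + 1) * s = c}"
    unfolding J vt[symmetric] using iff by (auto simp: tower_pts_def)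
  have proper: "\<not> (\<forall>x\<in>tower_pts n m. v \<bullet> x = c)"
  proof
    assume "\<forall>x\<in>tower_pts n m. v \<bullet> x = c"
    then have "tower_pts n m \<subseteq> F" using iff by blast
    then have "tower n m \<subseteq> F"
      unfolding tower_def using face_of_imp_convex[OF G(1)] by (intro hull_minimal) auto
    then show False using G face_of_imp_subset by blast
  qed
  show thesis
  proof (cases "v \<bullet> axis3 0 = 0 \<and> v \<bullet> axis3 1 = 0 \<and> v \<bullet> axis3 2 = 0")
    case True
    then have vb: "v \<bullet> base_pt k = 0" for k using functional_zero_imp_const by blast
    have g: "g = 0" using True by (simp add: g_def)
    show thesis
    proof (cases "c = 0")
      case c: True
      have "s \<noteq> 0"
      proof
        assume "s = 0"
        then have "\<forall>x\<in>tower_pts n m. v \<bullet> x = c" using g c vb vt by (auto simp: tower_pts_def)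
        then show False using proper by blast
      qed
      then have "J = {}" unfolding Jv using g c by (auto simp: add_nonneg_eq_0_iff)
      moreover have "K = {..n}" unfolding Kv using vb c by auto
      ultimately show thesis by (intro base)
    next
      case False
      then have "K = {}" unfolding Kv using vb by auto
      moreover obtain i j where "J \<subseteq> {i, j}"
        unfolding Jv using quadratic_root_set[of g s c "\<lambda>j. j \<in> {1..m}"] False by blast
      ultimately show thesis by (intro small[of 0 1 i j]) auto
    qed
  next
    case False
    consider a b where "a < b" "b \<le> a + 3" "K \<subseteq> {a, b}" | i where "i \<le> n" "K = facet_idx n i"
      using functional_zero_set[OF n geb False] unfolding Kv by blast
    then show thesis
    proof cases
      case 1
      \<comment> \<open>Otherwise the functional vanishes on the whole diagonal axis. That axis
        meets the triangle x_0 x_1 x_2 in its interior, as (4 x_0 + x_1 + x_2) / 6 = (2, 2, 2), so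
        the functional is 0 at these three linearly independent points.\<close>
      have "\<not> (g = 0 \<and> s = 0 \<and> c = 0)"
      proof
        assume z: "g = 0 \<and> s = 0 \<and> c = 0"
        have b0: "v \<bullet> base_pt 0 = 2 * (v \<bullet> axis3 2)"
          by (simp add: inner_base_pt oblong_def numeral_2_eq_2)
        have b1: "v \<bullet> base_pt 1 = v \<bullet> base_pt 0 + 6 * (v \<bullet> axis3 0)"
          using base_pt_Suc[of 0] by (simp add: inner_simps)
        have b2: "v \<bullet> base_pt 2 = v \<bullet> base_pt 1 + 12 * (v \<bullet> axis3 1)"
          using base_pt_Suc[of 1] by (simp add: inner_simps numeral_2_eq_2)
        have "0 \<le> v \<bullet> base_pt 0" "0 \<le> v \<bullet> base_pt 1" "0 \<le> v \<bullet> base_pt 2"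
          using geb[of 0] geb[of 1] geb[of 2] z n by auto
        then have "0 \<le> v \<bullet> axis3 2" "0 \<le> 2 * (v \<bullet> axis3 2) + 6 * (v \<bullet> axis3 0)"
          "0 \<le> 2 * (v \<bullet> axis3 2) + 6 * (v \<bullet> axis3 0) + 12 * (v \<bullet> axis3 1)"
          unfolding b2 b1 b0 by simp_all
        then have "v \<bullet> axis3 2 = 0" "v \<bullet> axis3 0 = 0" "v \<bullet> axis3 1 = 0"
          using z unfolding g_def by linarith+
        then show False using False by blast
      qed
      then obtain i j where "J \<subseteq> {i, j}"
        unfolding Jv using quadratic_root_set[of g s c "\<lambda>j. j \<in> {1..m}"] by blast
      then show thesis using 1 by (intro small[of a b i j])
    next
      case 2
      note ff = facet_functional[OF n 2(1) geb 2(2)[unfolded Kv] g_def]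
      have g0: "g \<noteq> 0" using ff(4) False by blast
      \<comment> \<open>Both forms are, up to sign, products of two integers of different parity,
        hence even.\<close>
      define B where "B = (if i = n then - (int n * (int n - 1)) else (int i + 2) * (int i - 1))"
      have B: "even B" by (auto simp: B_def)
      have cB: "c = - g * of_int B"
        using ff(1,2) 2(1) by (cases "i = n") (auto simp: B_def oblong_def)
      have uniq: "j = l" if "j \<in> J" "l \<in> J" for j l
      proof (rule ccontr)
        assume "j \<noteq> l"
        from odd_product_no_root_pair[OF g0 B this, of s] that show False
          unfolding Jv cB by simp
      qed
      have loc: "j = i div 2" if "j \<in> J" "2 \<le> i" "i + 2 \<le> n" for j
      proof (rule minimizer_position)
        have "0 \<le> g" using ff(3) that by simp
        then show "0 < g" using g0 by simp
        show "2 \<le> i" "i \<le> 2 * m + 1" using that nm by auto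
        have c: "c = - g * ((real i + 2) * (real i - 1))" using ff(1) that by simp
        show "0 \<le> (2 * real l + 1)\<^sup>2 * g + (2 * real l + 1) * s + g * ((real i + 2) * (real i - 1))"
          if "1 \<le> l" "l \<le> m" for l using get[OF that] c by simp
        show "(2 * real j + 1)\<^sup>2 * g + (2 * real j + 1) * s + g * ((real i + 2) * (real i - 1)) = 0"
          using that(1) c unfolding Jv by simp
      qed
      show thesis
      proof (cases "J = {}")
        case True
        then show thesis using 2 by (intro facet[of i "i div 2"]) auto
      next
        case False
        then obtain j where "j \<in> J" by blast
        then show thesis using 2 uniq loc by (intro facet[of i j]) auto
      qed
    qed
  qed
qed

text \<open>The vertex order \<open>x\<^sub>0, x\<^sub>1, x\<^sub>2, y\<^sub>1, x\<^sub>3, x\<^sub>4, y\<^sub>2, x\<^sub>5, \<dots>\<close> is encoded by the keys \<open>2 k\<close> for \<open>x\<^sub>k\<close> and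
  \<open>4 j + 1\<close> for \<open>y\<^sub>j\<close>.\<close>

definition keyed_pt :: "nat \<Rightarrow> real^4" where
  "keyed_pt c = (if even c then base_pt (c div 2) else top_pt (c div 4))"

definition keys :: "nat set \<Rightarrow> nat set \<Rightarrow> nat set" where
  "keys K J = (\<lambda>k. 2 * k) ` K \<union> (\<lambda>j. 4 * j + 1) ` J"

definition tower_list :: "nat \<Rightarrow> nat \<Rightarrow> (real^4) list" where
  "tower_list n m = map keyed_pt (sorted_list_of_set (keys {..n} {1..m}))"

lemma finite_keys: "finite K \<Longrightarrow> finite J \<Longrightarrow> finite (keys K J)"
  by (simp add: keys_def)

lemma keyed_pt_simps: "keyed_pt (2 * k) = base_pt k" "keyed_pt (4 * j + 1) = top_pt j"
proof -
  have "(4 * j + 1) div 4 = j" by simp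
  then show "keyed_pt (2 * k) = base_pt k" "keyed_pt (4 * j + 1) = top_pt j"
    by (simp_all add: keyed_pt_def)
qed

lemma keyed_pt_image: "keyed_pt ` keys K J = base_pt ` K \<union> top_pt ` J"
  by (simp add: keys_def image_Un image_image keyed_pt_simps del: add_Suc_right One_nat_def)

lemma inj_on_keyed_pt: "inj_on keyed_pt (keys K J)"
proof (rule inj_onI)
  fix c d assume "c \<in> keys K J" "d \<in> keys K J" and eq: "keyed_pt c = keyed_pt d"
  then have "(\<exists>k. c = 2 * k) \<or> (\<exists>j. c = 4 * j + 1)" "(\<exists>k. d = 2 * k) \<or> (\<exists>j. d = 4 * j + 1)"
    unfolding keys_def by blast+
  then show "c = d"
    using eq
    by (elim disjE exE)
      (simp_all only: keyed_pt_simps base_pt_eq_iff top_pt_eq_iff top_pt_ne_base_pt top_pt_ne_base_pt[symmetric])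
qed

lemma vertex_ordering_tower:
  assumes "3 \<le> n"
  shows "vertex_ordering (tower n m) (tower_list n m)"
  using vertices_tower[OF assms] inj_on_keyed_pt[of "{..n}" "{1..m}"] keyed_pt_image[of "{..n}" "{1..m}"]
  by (simp add: vertex_ordering_def tower_list_def distinct_map tower_pts_def finite_keys)

lemma filter_sorted_list_of_set:
  assumes "finite A"
  shows "filter P (sorted_list_of_set A) = sorted_list_of_set {x \<in> A. P x}"
  using assms by (intro sorted_distinct_set_unique) (auto simp: sorted_wrt_filter)

lemma filter_tower_list:
  assumes "K = {k. k \<le> n \<and> base_pt k \<in> F}" "J = {j. j \<in> {1..m} \<and> top_pt j \<in> F}"
  shows "filter (\<lambda>v. v \<in> F) (tower_list n m) = map keyed_pt (sorted_list_of_set (keys K J))"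
proof -
  have "{c \<in> keys {..n} {1..m}. keyed_pt c \<in> F} = keys K J"
  proof (intro set_eqI iffI)
    fix c assume "c \<in> {c \<in> keys {..n} {1..m}. keyed_pt c \<in> F}"
    then have "(\<exists>k\<le>n. c = 2 * k) \<or> (\<exists>j\<in>{1..m}. c = 4 * j + 1)" "keyed_pt c \<in> F"
      by (auto simp: keys_def)
    then show "c \<in> keys K J"
      unfolding assms keys_def
      by (elim disjE bexE exE conjE) (simp_all only: keyed_pt_simps, auto)
  next
    fix c assume "c \<in> keys K J"
    then have "(\<exists>k\<in>K. c = 2 * k) \<or> (\<exists>j\<in>J. c = 4 * j + 1)" by (auto simp: keys_def)
    then show "c \<in> {c \<in> keys {..n} {1..m}. keyed_pt c \<in> F}"
    proof
      assume "\<exists>k\<in>K. c = 2 * k"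
      then obtain k where "k \<in> K" "c = 2 * k" by blast
      then show ?thesis using keyed_pt_simps(1)[of k] by (auto simp: assms keys_def)
    next
      assume "\<exists>j\<in>J. c = 4 * j + 1"
      then obtain j where "j \<in> J" "c = 4 * j + 1" by blast
      then show ?thesis using keyed_pt_simps(2)[of j] by (auto simp: assms keys_def)
    qed
  qed
  then show ?thesis
    by (simp add: tower_list_def filter_map comp_def filter_sorted_list_of_set finite_keys)
qed

lemma face_hull_vertices:
  assumes "3 \<le> n" "F face_of tower n m"
    and "K = {k. k \<le> n \<and> base_pt k \<in> F}" "J = {j. j \<in> {1..m} \<and> top_pt j \<in> F}"
  shows "vertices F = base_pt ` K \<union> top_pt ` J" "F = convex hull (base_pt ` K \<union> top_pt ` J)"
proof -
  show v: "vertices F = base_pt ` K \<union> top_pt ` J"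
    using vertices_face[OF assms(2)] vertices_tower[OF assms(1), of m] assms(3,4)
    by (auto simp: tower_pts_def)
  have "polytope F" using face_of_polytope_polytope[OF polytope_tower assms(2)] .
  then show "F = convex hull (base_pt ` K \<union> top_pt ` J)"
    using polytope_eq_hull_vertices v by metis
qed

text \<open>The order of the vertices matters only for the base, for a trapezoid and for a pyramid
  over one; all other proper faces are simplices.\<close>

lemma multiplex_face_tower:
  assumes n: "3 \<le> n" and nm: "n \<le> 2 * m + 3"
    and F: "F face_of tower n m" "F \<noteq> tower n m"
  shows "multiplex F (filter (\<lambda>v. v \<in> F) (tower_list n m))"
proof -
  define K where "K = {k. k \<le> n \<and> base_pt k \<in> F}"
  define J where "J = {j. j \<in> {1..m} \<and> top_pt j \<in> F}"
  have fin: "finite (keys K J)" by (simp add: finite_keys K_def J_def)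
  define xs where "xs = map keyed_pt (sorted_list_of_set (keys K J))"
  have filt: "filter (\<lambda>v. v \<in> F) (tower_list n m) = xs"
    unfolding xs_def by (rule filter_tower_list[OF K_def J_def])
  note hull = face_hull_vertices[OF n F(1) K_def J_def]
  have xs: "distinct xs" "set xs = base_pt ` K \<union> top_pt ` J"
    using inj_on_keyed_pt[of K J] keyed_pt_image[of K J] fin by (simp_all add: xs_def distinct_map)
  have simplex: "multiplex F xs" if "\<not> affine_dependent S" "base_pt ` K \<union> top_pt ` J \<subseteq> S" for S
    using multiplex_simplex[OF affine_independent_subset[OF that] xs] hull(2) by simp
  have ord: "vertex_ordering F xs" using xs hull(1) by (simp add: vertex_ordering_def)
  have sorted: "xs = map keyed_pt cs" if "sorted_wrt (<) cs" "set cs = keys K J" for cs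
    using that sorted_list_of_set_unique[OF fin, of cs] fin
    by (metis strict_sorted_iff xs_def sorted_list_of_set.idem_if_sorted_distinct)
  from n nm F K_def J_def have "multiplex F xs"
  proof (cases rule: face_vertex_sets)
    case base
    have "F = base n" using hull(2) base by (simp add: base_def)
    moreover have "xs = map keyed_pt (map (\<lambda>k. 2 * k) [0..<Suc n])"
    proof (rule sorted)
      show "sorted_wrt (<) (map (\<lambda>k. 2 * k) [0..<Suc n])"
        by (simp add: sorted_wrt_map del: upt_Suc)
      show "set (map (\<lambda>k. 2 * k) [0..<Suc n]) = keys K J"
        using base by (auto simp: keys_def simp del: upt_Suc)
    qed
    then have "xs = map base_pt [0..<Suc n]" by (simp add: comp_def keyed_pt_simps del: upt_Suc)
    ultimately show ?thesis using multiplex_base[OF n] by simp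
  next
    case (small a b i j)
    \<comment> \<open>If the two top indices coincide, a second one is made up, since independence
      passes to subsets.\<close>
    define j' where "j' = (if j = i then Suc i else j)"
    have "\<not> affine_dependent {top_pt i, top_pt j', base_pt a, base_pt b}"
      using small by (intro two_two_independent) (auto simp: j'_def)
    moreover have "base_pt ` K \<union> top_pt ` J \<subseteq> {top_pt i, top_pt j', base_pt a, base_pt b}"
      using small by (auto simp: j'_def split: if_splits)
    ultimately show ?thesis by (rule simplex)
  next
    case (facet i j)
    \<comment> \<open>This settles F_0, F_1, F_(n-1) and F_n, whose indices fit into four
      consecutive ones.\<close>
    have triangle: ?thesis if "facet_idx n i \<subseteq> {k, k + 1, k + 2, k + 3}" for k
    proof (rule simplex)
      show "\<not> affine_dependent {top_pt j, base_pt k, base_pt (k + 1), base_pt (k + 2), base_pt (k + 3)}"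
        by (rule four_consecutive_top_independent)
      show "base_pt ` K \<union> top_pt ` J \<subseteq> {top_pt j, base_pt k, base_pt (k + 1), base_pt (k + 2), base_pt (k + 3)}"
        using that facet by auto
    qed
    consider "i < 2" | "n \<le> i + 1" | "2 \<le> i" "i + 2 \<le> n" by linarith
    then show ?thesis
    proof cases
      case 1
      then show ?thesis using n by (intro triangle[of 0]) (auto simp: facet_idx_def)
    next
      case 2
      then show ?thesis using n facet(1) by (intro triangle[of "n - 3"]) (auto simp: facet_idx_def)
    next
      case 3
      define k where "k = i - 2"
      have i: "i = k + 2" using 3 by (simp add: k_def)
      have K': "K = {k, k + 1, k + 3, k + 4}"
        unfolding facet(2) i using 3 i by (auto simp: facet_idx_def)
      have p: "axis3 (k + 3) = axis3 k" by (rule axis3_period)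
      have step1: "base_pt (k + 1) - base_pt k = (6 * (real k + 1)) *\<^sub>R axis3 k"
        using base_pt_Suc[of k] by simp
      have step2: "base_pt (k + 4) = base_pt (k + 3) + (6 * (real k + 4)) *\<^sub>R axis3 k"
        using base_pt_Suc[of "k + 3"] p by (simp add: eval_nat_numeral algebra_simps)
      define r where "r = (real k + 4) / (real k + 1)"
      have r: "0 < r" by (simp add: r_def)
      have par: "base_pt (k + 4) = base_pt (k + 3) + r *\<^sub>R (base_pt (k + 1) - base_pt k)"
      proof -
        have "r * (6 * (real k + 1)) = 6 * (real k + 4)" by (simp add: r_def field_simps)
        then show ?thesis unfolding step1 step2 scaleR_scaleR by simp
      qed
      have ind: "\<not> affine_dependent {base_pt k, base_pt (k + 1), base_pt (k + 3)}"
        by (rule affine_independent_subset[OF four_consecutive_independent[of k]]) auto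
      have ne: "base_pt k \<noteq> base_pt (k + 1)" "base_pt k \<noteq> base_pt (k + 3)" "base_pt (k + 1) \<noteq> base_pt (k + 3)"
        by (simp_all add: base_pt_eq_iff)
      consider "J = {}" | "J = {j}" using facet(3) by blast
      then show ?thesis
      proof cases
        case 1
        have "xs = map keyed_pt [2 * k, 2 * (k + 1), 2 * (k + 3), 2 * (k + 4)]"
          by (rule sorted) (auto simp: K' 1 keys_def)
        then have xs4: "xs = [base_pt k, base_pt (k + 1), base_pt (k + 3), base_pt (k + 4)]"
          by (simp only: list.map keyed_pt_simps)
        have "F = convex hull {base_pt k, base_pt (k + 1), base_pt (k + 3), base_pt (k + 4)}"
          using hull(2) by (simp add: K' 1)
        then show ?thesis
          using multiplex_trapezoid[OF ind ne r par] ord by (simp only: xs4)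
      next
        case 2
        have j: "j = i div 2" using facet(4) 3 by simp
        \<comment> \<open>The key 4 (i div 2) + 1 is 2 i + 1 or 2 i - 1, between the keys 2 (i - 1)
          and 2 (i + 1).\<close>
        then have jb: "2 * (k + 1) < 4 * j + 1" "4 * j + 1 < 2 * (k + 3)" unfolding i by presburger+
        have "xs = map keyed_pt [2 * k, 2 * (k + 1), 4 * j + 1, 2 * (k + 3), 2 * (k + 4)]"
          by (rule sorted) (use jb in \<open>auto simp: K' 2 keys_def\<close>)
        then have xs5: "xs = [base_pt k, base_pt (k + 1), top_pt j, base_pt (k + 3), base_pt (k + 4)]"
          by (simp only: list.map keyed_pt_simps)
        have "F = convex hull {base_pt k, base_pt (k + 1), top_pt j, base_pt (k + 3), base_pt (k + 4)}"
          using hull(2) by (simp add: K' 2 insert_commute)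
        moreover have "top_pt j \<notin> affine hull {base_pt k, base_pt (k + 1), base_pt (k + 3)}"
          by (rule top_pt_notin_affine_hull) auto
        ultimately show ?thesis
          using multiplex_pyramid_trapezoid[OF ind ne r par] ord by (simp only: xs5)
      qed
    qed
  qed
  then show ?thesis by (simp only: filt)
qed

theorem theorem5p1:
  fixes q :: nat
  assumes "q \<ge> 5"
  shows "\<exists>P :: (real^4) set. order_multiplicial P \<and> aff_dim P = 4 \<and> card (vertices P) = q \<and>
           (\<exists>F. F facet_of P \<and> int (card (vertices P \<inter> F)) = \<lceil>(2 * real q + 2) / 3\<rceil>)"
proof -
  \<comment> \<open>This is the largest n for which m = q - 1 - n top points suffice, that is, n <=
    2 m + 3.\<close>
  define n where "n = (2 * q + 1) div 3"
  define m where "m = q - 1 - n"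
  have n: "3 \<le> n" and m: "1 \<le> m" and nm: "n \<le> 2 * m + 3" and q: "q = Suc n + m"
    using assms unfolding m_def n_def by linarith+
  have "order_multiplicial (tower n m)"
    unfolding order_multiplicial_def
    using polytope_tower vertex_ordering_tower[OF n] multiplex_face_tower[OF n nm] by blast
  moreover have "aff_dim (tower n m) = 4" by (rule aff_dim_tower[OF n m])
  moreover have "card (vertices (tower n m)) = q" using vertices_tower[OF n] card_tower_pts q by simp
  moreover have "base n facet_of tower n m"
    using base_face_tower aff_dim_base[OF n] aff_dim_tower[OF n m] by (auto simp: facet_of_def)
  moreover have "int (card (vertices (tower n m) \<inter> base n)) = \<lceil>(2 * real q + 2) / 3\<rceil>"
  proof -
    have "vertices (tower n m) \<inter> base n = base_pt ` {..n}"
      using vertices_face[OF base_face_tower, of n m] vertices_base[OF n] by simp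
    then have "card (vertices (tower n m) \<inter> base n) = Suc n"
      by (simp add: card_image inj_on_def base_pt_eq_iff)
    moreover have "\<lceil>(2 * real q + 2) / 3\<rceil> = int (Suc n)"
    proof (rule ceiling_unique)
      have "3 * n \<le> 2 * q + 1" "2 * q + 2 \<le> 3 * n + 3" unfolding n_def by linarith+
      then have "real (3 * n) \<le> real (2 * q + 1)" "real (2 * q + 2) \<le> real (3 * n + 3)"
        by (simp_all only: of_nat_le_iff)
      then show "real_of_int (int (Suc n)) - 1 < (2 * real q + 2) / 3"
        "(2 * real q + 2) / 3 \<le> real_of_int (int (Suc n))" by simp_all
    qed
    ultimately show ?thesis by simp
  qed
  ultimately show ?thesis by blast
qed

end
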